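(* Let $\dot x = Ax+\sum_{i=1}^mB_iu_i$, $y_i=C_ix$ be an $n$-dimensional, jointly controllable and jointly observable $m$-channel continuous-time linear system (with $u_i\in\mathbb{R}^{p_i}$, $y_i\in\mathbb{R}^{q_i}$) whose neighbor graph is strongly connected. Let nonnegative integers $n_1,\dots,n_m$ be given and let $\{\bar A,\bar B_i,\bar C_i;m\}$ be the extended $m$-channel system of dimension $\bar n=n+\sum_i n_i$ with $$\bar A=\begin{bmatrix}A&0\\0&0\end{bmatrix},\quad \bar B_i=\begin{bmatrix}B_i&0\\0&E_i\end{bmatrix},\quad \bar C_i=\begin{bmatrix}C_i&0\\0&E_{\mathcal{N}_i}'\end{bmatrix},$$ where $E_i$ is the $(\sum_k n_k)\times n_i$ block column matrix whose $i$th block is $I_{n_i}$ and whose other blocks $\mathbf{0}_{n_k\times n_i}$ are zero, and for $\mathbf{s}=\{i_1<\dots<i_s\}\subset\{1,\dots,m\}$, $E_{\mathbf{s}}=[E_{i_1}\ \cdots\ E_{i_s}]$ (this models local controllers $\dot z_i=v_i$, $z_i\in\mathbb{R}^{n_i}$, with each agent $i$ measuring $y_i$ and the $z_j$, $j\in\mathcal{N}_i$). If $$n_i\ \ge\ n-\min_{\mathbf{s}\subset\{1,\dots,m\},\ \lambda\in\sigma(A)}\mathrm{rank}\begin{bmatrix}\lambda I_n-A & B_{\mathbf{s}}\\ C_{\{1,\dots,m\}-\mathbf{s}}&0\end{bmatrix}\quad\text{for all } i\in\{1,\dots,m\},$$ then the extended system $\{\bar A,\bar B_i,\bar C_i;m\}$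 has no fixed spectrum.
   Context: Jointly controllable: $(A,[B_1\ \cdots\ B_m])$ controllable; jointly observable: $(\mathrm{column}\{C_1,\dots,C_m\},A)$ observable. The neighbor graph is a directed graph on $\{1,\dots,m\}$ with an arc $j\to i$ iff $j$ is a neighbor of $i$; $\mathcal{N}_i$ is the set of neighbors of $i$ including $i$. For $\mathbf{s}=\{i_1<\dots<i_s\}$, $B_{\mathbf{s}}=[B_{i_1}\ \cdots\ B_{i_s}]$ and $C_{\mathbf{s}}=\mathrm{column}\{C_{i_1},\dots,C_{i_s}\}$ (empty when $\mathbf{s}=\emptyset$). $\sigma(A)$ is the spectrum of $A$. The fixed spectrum of an $m$-channel system $\{A,B_i,C_i;m\}$ is the set of eigenvalues of $A+\sum_{i=1}^mB_iF_iC_i$ that do not change as the real matrices $F_1,\dots,F_m$ range over all values. *)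

theory Defs
  imports "Jordan_Normal_Form.Char_Poly" "Jordan_Normal_Form.DL_Rank"
begin

text \<open>Rank of a matrix (column rank, i.e. dimension of the column space).\<close>
definition mrank :: "'a::field mat \<Rightarrow> nat" where
  "mrank M = vec_space.rank (dim_row M) M"

text \<open>Horizontal / vertical concatenation of the matrices indexed by a set of channels,
  in increasing index order; r (resp. c) is the number of rows (resp. columns),
  needed when the index set is empty.\<close>
definition hcat :: "nat \<Rightarrow> (nat \<Rightarrow> 'a::zero mat) \<Rightarrow> nat set \<Rightarrow> 'a mat" where
  "hcat r M s = mat_of_cols r (concat (map (\<lambda>i. cols (M i)) (sorted_list_of_set s)))"

definition vcat :: "nat \<Rightarrow> (nat \<Rightarrow> 'a::zero mat) \<Rightarrow> nat set \<Rightarrow> 'a mat" where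
  "vcat c M s = mat_of_rows c (concat (map (\<lambda>i. rows (M i)) (sorted_list_of_set s)))"

text \<open>Controllability (Kalman rank condition) of (A,B), A n x n.\<close>
definition controllable :: "real mat \<Rightarrow> real mat \<Rightarrow> bool" where
  "controllable A B = (let n = dim_row A in
     mrank (mat_of_cols n (concat (map (\<lambda>k. cols (A ^\<^sub>m k * B)) [0..<n]))) = n)"

text \<open>Observability of (C,A).\<close>
definition observable :: "real mat \<Rightarrow> real mat \<Rightarrow> bool" where
  "observable C A = (let n = dim_row A in
     mrank (mat_of_rows n (concat (map (\<lambda>k. rows (C * A ^\<^sub>m k)) [0..<n]))) = n)"

text \<open>Neighbor graph: arc j -> i iff j is a neighbor of i (channels 0..m-1).\<close>
definition nbr_arcs :: "nat \<Rightarrow> (nat \<Rightarrow> nat set) \<Rightarrow> (nat \<times> nat) set" where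
  "nbr_arcs m N = {(j, i). i < m \<and> j \<in> N i}"

definition strongly_connected_nbr :: "nat \<Rightarrow> (nat \<Rightarrow> nat set) \<Rightarrow> bool" where
  "strongly_connected_nbr m N = (\<forall>i<m. \<forall>j<m. (i, j) \<in> (nbr_arcs m N)\<^sup>*)"

text \<open>Fixed spectrum of the m-channel system {A, B_i, C_i; m} (A n x n, B_i n x p_i, C_i q_i x n):
  complex eigenvalues of A + sum B_i F_i C_i common to all real F_i.\<close>
definition closed_loop :: "real mat \<Rightarrow> (nat \<Rightarrow> real mat) \<Rightarrow> (nat \<Rightarrow> real mat) \<Rightarrow> nat
    \<Rightarrow> (nat \<Rightarrow> real mat) \<Rightarrow> real mat" where
  "closed_loop A B C m F = mat (dim_row A) (dim_col A)
     (\<lambda>rc. A $$ rc + (\<Sum>i<m. (B i * F i * C i) $$ rc))"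

definition fixed_spectrum :: "real mat \<Rightarrow> (nat \<Rightarrow> real mat) \<Rightarrow> (nat \<Rightarrow> real mat) \<Rightarrow> nat
    \<Rightarrow> complex set" where
  "fixed_spectrum A B C m = {lam. \<forall>F. (\<forall>i<m. F i \<in> carrier_mat (dim_col (B i)) (dim_row (C i))) \<longrightarrow>
       eigenvalue (map_mat complex_of_real (closed_loop A B C m F)) lam}"

text \<open>Extended system. nn i = n_i; offsets of the blocks z_i in the stacked z.\<close>
definition zoff :: "(nat \<Rightarrow> nat) \<Rightarrow> nat \<Rightarrow> nat" where
  "zoff nn i = (\<Sum>k<i. nn k)"

text \<open>E_i : (sum_k n_k) x n_i, i-th block identity, others zero.\<close>
definition Emat :: "nat \<Rightarrow> (nat \<Rightarrow> nat) \<Rightarrow> nat \<Rightarrow> real mat" where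
  "Emat m nn i = mat (\<Sum>k<m. nn k) (nn i) (\<lambda>(r, c). if r = zoff nn i + c then 1 else 0)"

definition Eset :: "nat \<Rightarrow> (nat \<Rightarrow> nat) \<Rightarrow> nat set \<Rightarrow> real mat" where
  "Eset m nn s = hcat (\<Sum>k<m. nn k) (Emat m nn) s"

definition Abar :: "real mat \<Rightarrow> nat \<Rightarrow> (nat \<Rightarrow> nat) \<Rightarrow> real mat" where
  "Abar A m nn = (let n = dim_row A; N = (\<Sum>k<m. nn k) in
     four_block_mat A (0\<^sub>m n N) (0\<^sub>m N n) (0\<^sub>m N N))"

definition Bbar :: "real mat \<Rightarrow> (nat \<Rightarrow> real mat) \<Rightarrow> nat \<Rightarrow> (nat \<Rightarrow> nat) \<Rightarrow> nat \<Rightarrow> real mat" where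
  "Bbar A B m nn i = (let n = dim_row A; N = (\<Sum>k<m. nn k) in
     four_block_mat (B i) (0\<^sub>m n (nn i)) (0\<^sub>m N (dim_col (B i))) (Emat m nn i))"

definition Cbar :: "real mat \<Rightarrow> (nat \<Rightarrow> real mat) \<Rightarrow> nat \<Rightarrow> (nat \<Rightarrow> nat) \<Rightarrow> (nat \<Rightarrow> nat set)
    \<Rightarrow> nat \<Rightarrow> real mat" where
  "Cbar A C m nn N i = (let n = dim_row A; Et = transpose_mat (Eset m nn (N i)) in
     four_block_mat (C i) (0\<^sub>m (dim_row (C i)) (dim_col Et)) (0\<^sub>m (dim_row Et) n) Et)"

text \<open>The PBH-type matrix [lambda I - A, B_s; C_{complement of s}, 0] over the complex numbers.\<close>
definition pbh_mat :: "real mat \<Rightarrow> (nat \<Rightarrow> real mat) \<Rightarrow> (nat \<Rightarrow> real mat) \<Rightarrow> nat \<Rightarrow> nat set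
    \<Rightarrow> complex \<Rightarrow> complex mat" where
  "pbh_mat A B C m s lam = (let n = dim_row A;
      Bs = map_mat complex_of_real (hcat n B s);
      Cs = map_mat complex_of_real (vcat n C ({0..<m} - s)) in
     four_block_mat (lam \<cdot>\<^sub>m 1\<^sub>m n - map_mat complex_of_real A) Bs Cs (0\<^sub>m (dim_row Cs) (dim_col Bs)))"

end

theory Submission
  imports Defs "HOL-Library.Function_Algebras" "HOL-Library.Product_Plus"
begin

text \<open>
  The matrix \<open>lam I - A - \<Sum> B\<^sub>i F\<^sub>i C\<^sub>i\<close> is \<open>lam I - A\<close> plus a combination of
  rank-one matrices \<open>b c\<^sup>T\<close>, one for each pair of a column \<open>b\<close> of \<open>B\<^sub>i\<close> and a row \<open>c\<close>
  of \<open>C\<^sub>i\<close>, whose coefficients are free.  For all \<open>x\<close> but finitely many,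
  \<open>rank (M + x b c\<^sup>T) \<ge> k\<close> as soon as \<open>rank [M, b] \<ge> k\<close> and \<open>rank [M; c] \<ge> k\<close>.
  Choosing the coefficients one at a time, so that every bordered matrix keeps its rank at each
  step, shows that \<open>lam\<close> is not fixed if \<open>[lam I - A, B\<^sub>S; C\<^sub>T, 0]\<close> has full rank for every
  set \<open>S\<close> of channels with complement \<open>T\<close>.

  In the extended system this bordered matrix splits into the one of the original system
  and one for the controller states.  The latter has rank at least \<open>\<Sum> n\<^sub>i + n\<^sub>k\<close> for some \<open>k\<close> when
  \<open>S\<close> is neither empty nor everything, because strong connectivity makes some channel outside
  \<open>S\<close> measure \<open>z\<^sub>k\<close> for a \<open>k\<close> in \<open>S\<close>; the bound on \<open>n\<^sub>k\<close> says that this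
  compensates the rank defect of the former.  If \<open>S\<close> is empty or everything, observability or
  controllability leaves no defect.
\<close>

subsection \<open>Rank of bilinear forms\<close>

text \<open>Padding \<open>Y\<close> with zero rows to a square matrix makes the determinant vanish,
  and a singular square matrix has a nonzero kernel vector.\<close>

lemma wide_kernel:
  fixes Y :: "nat \<Rightarrow> nat \<Rightarrow> 'a::field"
  assumes "r < c"
  shows "\<exists>v. (\<exists>j<c. v j \<noteq> 0) \<and> (\<forall>i<r. (\<Sum>j<c. Y i j * v j) = 0)"
proof -
  define M where "M = mat c c (\<lambda>(i, j). if i < r then Y i j else 0)"
  have M: "M \<in> carrier_mat c c" by (simp add: M_def)
  \<comment> \<open>Row \<open>r\<close> of \<open>M\<close> is one of the padded zero rows, so this
    unit vector lies in the kernel of the transpose.\<close>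
  have "transpose_mat M *\<^sub>v unit_vec c r = 0\<^sub>v c"
    using assms by (intro eq_vecI) (auto simp: M_def scalar_prod_def unit_vec_def)
  moreover have "unit_vec c r \<noteq> (0\<^sub>v c :: 'a vec)"
    using assms by (metis index_unit_vec(2) index_zero_vec(1) zero_neq_one)
  ultimately have "det (transpose_mat M) = 0"
    using det_0_iff_vec_prod_zero_field[of "transpose_mat M" c] M by force
  then have "det M = 0" using det_transpose[OF M] by simp
  then obtain v where v: "v \<in> carrier_vec c" "v \<noteq> 0\<^sub>v c" "M *\<^sub>v v = 0\<^sub>v c"
    using det_0_iff_vec_prod_zero_field[OF M] by blast
  have "\<exists>j<c. v $ j \<noteq> 0"
    using v(1,2) by (metis carrier_vecD eq_vecI index_zero_vec(1) index_zero_vec(2))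
  moreover have "(\<Sum>j<c. Y i j * v $ j) = 0" if "i < r" for i
  proof -
    have "(\<Sum>j<c. Y i j * v $ j) = (M *\<^sub>v v) $ i"
      using that assms v(1) by (simp add: M_def scalar_prod_def atLeast0LessThan)
    then show ?thesis using v(3) that assms by simp
  qed
  ultimately show ?thesis by blast
qed

lemma sum_mult_delta:
  fixes f :: "nat \<Rightarrow> 'a::semiring_1"
  assumes "j < r"
  shows "(\<Sum>l<r. f l * (if l = j then 1 else 0)) = f j" "(\<Sum>l<r. f l * (if j = l then 1 else 0)) = f j"
    "(\<Sum>l<r. (if l = j then 1 else 0) * f l) = f j" "(\<Sum>l<r. (if j = l then 1 else 0) * f l) = f j"
  using assms by (simp_all add: if_distrib if_distribR cong: if_cong)

text \<open>If the identity of size \<open>k\<close> factored through fewer than \<open>k\<close>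
  dimensions, a nonzero kernel vector of \<open>Y\<close> would be both fixed and annihilated by the
  product.\<close>

lemma identity_factor:
  fixes X Y :: "nat \<Rightarrow> nat \<Rightarrow> 'a::field"
  assumes "\<And>i j. i < k \<Longrightarrow> j < k \<Longrightarrow> (\<Sum>l<r. X i l * Y l j) = (if i = j then 1 else 0)"
  shows "k \<le> r"
proof (rule ccontr)
  assume "\<not> k \<le> r"
  then obtain v i where v: "\<And>l. l < r \<Longrightarrow> (\<Sum>j<k. Y l j * v j) = 0" and i: "i < k" "v i \<noteq> 0"
    using wide_kernel[of r k Y] by auto
  have "v i = (\<Sum>j<k. (\<Sum>l<r. X i l * Y l j) * v j)"
    using i assms by (simp add: sum_mult_delta)
  also have "\<dots> = (\<Sum>l<r. X i l * (\<Sum>j<k. Y l j * v j))"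
    unfolding sum_distrib_left sum_distrib_right by (subst sum.swap) (simp add: mult.assoc)
  also have "\<dots> = 0" using v by simp
  finally show False using i by simp
qed

text \<open>\<open>rank w \<ge> k\<close>: some \<open>k\<close> by \<open>k\<close> compression of \<open>w\<close> is the identity.\<close>
definition rank_ge :: "nat \<Rightarrow> ('u \<Rightarrow> 'v \<Rightarrow> 'f::zero_neq_one) \<Rightarrow> bool" where
  "rank_ge k w \<longleftrightarrow> (\<exists>p q. \<forall>i<k. \<forall>j<k. w (p i) (q j) = (if i = j then 1 else 0))"

lemma rank_ge_mono:
  assumes "rank_ge k w" "k' \<le> k"
  shows "rank_ge k' w"
proof -
  obtain p q where "\<forall>i<k. \<forall>j<k. w (p i) (q j) = (if i = j then 1 else 0)"
    using assms(1) unfolding rank_ge_def by blast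
  then show ?thesis using assms(2) unfolding rank_ge_def
    by (intro exI[of _ p] exI[of _ q]) simp
qed

text \<open>The scaling is a parameter, so that coordinate functions and pairs carrying border
  coordinates share one notion.\<close>

definition linear_functional :: "('f::field \<Rightarrow> 'u::ab_group_add \<Rightarrow> 'u) \<Rightarrow> ('u \<Rightarrow> 'f) \<Rightarrow> bool" where
  "linear_functional s f \<longleftrightarrow> (\<forall>x y. f (x + y) = f x + f y) \<and> (\<forall>t x. f (s t x) = t * f x)"

lemma linear_functionalD:
  assumes "linear_functional s f"
  shows "f (x + y) = f x + f y" "f (s t x) = t * f x" "f 0 = 0" "f (x - y) = f x - f y"
    "f (sum g K) = (\<Sum>k\<in>K. f (g k))"
proof -
  have add: "f (x + y) = f x + f y" for x y using assms by (simp add: linear_functional_def)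
  show "f (x + y) = f x + f y" "f (s t x) = t * f x" using assms by (simp_all add: linear_functional_def)
  show 0: "f 0 = 0" using add[of 0 0] by (metis add_cancel_right_left add_0)
  show "f (x - y) = f x - f y" using add[of "x - y" y] by simp
  show "f (sum g K) = (\<Sum>k\<in>K. f (g k))"
    by (induction K rule: infinite_finite_induct) (simp_all add: 0 add)
qed

locale bilinear_form =
  fixes su :: "'f::field \<Rightarrow> 'u::ab_group_add \<Rightarrow> 'u" and sv :: "'f \<Rightarrow> 'v::ab_group_add \<Rightarrow> 'v"
    and w :: "'u \<Rightarrow> 'v \<Rightarrow> 'f"
  assumes left: "\<And>v. linear_functional su (\<lambda>u. w u v)"
    and right: "\<And>u. linear_functional sv (w u)"
begin

lemmas lin = linear_functionalD[OF left] linear_functionalD[OF right]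

text \<open>Take the largest \<open>r < k\<close> for which some compression is the identity. The
  form is then recovered from the \<open>r\<close> chosen rows and columns (a skeleton
  decomposition), since any discrepancy would yield one more row and column.\<close>

lemma rank_dichotomy:
  assumes "\<not> rank_ge k w"
  shows "\<exists>r p q. r < k \<and> (\<forall>i<r. \<forall>j<r. w (p i) (q j) = (if i = j then 1 else 0))
    \<and> (\<forall>u v. w u v = (\<Sum>l<r. w u (q l) * w (p l) v))"
proof -
  have "rank_ge 0 w" by (simp add: rank_ge_def)
  then obtain r where r: "r < k" "rank_ge r w" "\<not> rank_ge (Suc r) w"
    using ex_least_nat_less[of "\<lambda>k. \<not> rank_ge k w" k] assms by blast
  then obtain p q where pq: "\<And>i j. i < r \<Longrightarrow> j < r \<Longrightarrow> w (p i) (q j) = (if i = j then 1 else 0)"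
    unfolding rank_ge_def by blast
  have "w u v = (\<Sum>l<r. w u (q l) * w (p l) v)" for u v
  proof (rule ccontr)
    assume ne: "w u v \<noteq> (\<Sum>l<r. w u (q l) * w (p l) v)"
    \<comment> \<open>The residuals of \<open>u\<close> and \<open>v\<close> after removing their
      components along the chosen vectors; \<open>w u' v'\<close> is exactly the
      discrepancy.\<close>
    define u' where "u' = u - (\<Sum>l<r. su (w u (q l)) (p l))"
    define v' where "v' = v - (\<Sum>l<r. sv (w (p l) v) (q l))"
    have u'q: "w u' (q j) = 0" if "j < r" for j
      using that by (simp add: u'_def lin pq sum_mult_delta)
    have pv': "w (p i) v' = 0" if "i < r" for i
      using that by (simp add: v'_def lin pq sum_mult_delta)
    have "w u' v' = w u' v" by (simp add: v'_def lin u'q)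
    also have "\<dots> = w u v - (\<Sum>l<r. w u (q l) * w (p l) v)" by (simp add: u'_def lin)
    finally have d: "w u' v' \<noteq> 0" using ne by simp
    have "w ((p(r := su (1 / w u' v') u')) i) ((q(r := v')) j) = (if i = j then 1 else 0)"
      if "i < Suc r" "j < Suc r" for i j
      using that d by (auto simp: less_Suc_eq pq u'q pv' lin)
    then have "rank_ge (Suc r) w" unfolding rank_ge_def by blast
    with r show False by simp
  qed
  with r(1) pq show ?thesis by blast
qed

text \<open>The last hypothesis says that \<open>[w, b]\<close> has rank at least \<open>k\<close>,
  where \<open>g\<close> holds the coordinates along the column \<open>b\<close>. If
  \<open>b\<close> vanished on the left kernel of \<open>w\<close>, it would factor through the same
  fewer than \<open>k\<close> functionals as \<open>w\<close>, and so would the bordered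
  identity.\<close>

lemma kernel_vector_left:
  assumes "\<not> rank_ge k w" and b: "linear_functional su b"
    and "\<And>i j. i < k \<Longrightarrow> j < k \<Longrightarrow> w (p i) (q j) + b (p i) * g j = (if i = j then 1 else 0)"
  shows "\<exists>u. b u = 1 \<and> (\<forall>v. w u v = 0)"
proof -
  note blin = linear_functionalD[OF b]
  obtain r p0 q0 where r: "r < k"
    and 0: "\<And>i j. i < r \<Longrightarrow> j < r \<Longrightarrow> w (p0 i) (q0 j) = (if i = j then 1 else 0)"
    and f: "\<And>u v. w u v = (\<Sum>l<r. w u (q0 l) * w (p0 l) v)"
    using rank_dichotomy[OF assms(1)] by blast
  \<comment> \<open>\<open>res\<close> projects onto the left kernel of \<open>w\<close>.\<close>
  define res where "res u = u - (\<Sum>l<r. su (w u (q0 l)) (p0 l))" for u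
  have res: "w (res u) v = 0" for u v
  proof -
    have "w (res u) v = w u v - (\<Sum>l<r. w u (q0 l) * w (p0 l) v)"
      by (simp add: res_def lin)
    then show ?thesis using f[of u v] by simp
  qed
  have "\<exists>u. b (res u) \<noteq> 0"
  proof (rule ccontr)
    assume "\<not> ?thesis"
    then have b0: "b (res u) = 0" for u by blast
    have bf: "b u = (\<Sum>l<r. w u (q0 l) * b (p0 l))" for u
    proof -
      have "b (res u) = b u - (\<Sum>l<r. w u (q0 l) * b (p0 l))" by (simp add: res_def blin)
      then show ?thesis using b0[of u] by simp
    qed
    have "k \<le> r"
    proof (rule identity_factor)
      fix i j assume "i < k" "j < k"
      then have "(if i = j then 1 else 0) = w (p i) (q j) + b (p i) * g j" using assms(3) by simp
      also have "\<dots> = (\<Sum>l<r. w (p i) (q0 l) * (w (p0 l) (q j) + b (p0 l) * g j))"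
        by (subst f, subst bf) (simp add: sum_distrib_left sum_distrib_right sum.distrib algebra_simps)
      finally show "(\<Sum>l<r. w (p i) (q0 l) * (w (p0 l) (q j) + b (p0 l) * g j)) = (if i = j then 1 else 0)"
        by simp
    qed
    with r show False by simp
  qed
  then obtain u where u: "b (res u) \<noteq> 0" by blast
  show ?thesis
    by (rule exI[of _ "su (1 / b (res u)) (res u)"]) (simp add: lin blin res u)
qed

end

lemma rank_ge_flip: "rank_ge k (\<lambda>v u. w u v) \<longleftrightarrow> rank_ge k w"
  unfolding rank_ge_def by (metis (full_types))

context bilinear_form begin

lemma flip: "bilinear_form sv su (\<lambda>v u. w u v)"
  by unfold_locales (fact right left)+

lemma kernel_vector_right:
  assumes "\<not> rank_ge k w" and c: "linear_functional sv c"
    and "\<And>i j. i < k \<Longrightarrow> j < k \<Longrightarrow> w (p i) (q j) + f i * c (q j) = (if i = j then 1 else 0)"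
  shows "\<exists>v. c v = 1 \<and> (\<forall>u. w u v = 0)"
proof -
  interpret F: bilinear_form sv su "\<lambda>v u. w u v" by (rule flip)
  have nr: "\<not> rank_ge k (\<lambda>v u. w u v)" using assms(1) rank_ge_flip[of k w] by blast
  have "w (p j) (q i) + c (q i) * f j = (if i = j then 1 else 0)" if "i < k" "j < k" for i j
    using assms(3)[OF that(2,1)] by (auto simp: mult.commute)
  then show ?thesis
    using F.kernel_vector_left[OF nr c, where p = q and q = p and g = f] by blast
qed

text \<open>If \<open>w\<close> already has rank \<open>k\<close>, the update compresses to the
  identity plus \<open>x\<close> times a rank-one matrix of trace \<open>t\<close>, which is
  singular only for \<open>1 + x * t = 0\<close>. Otherwise the rank is exactly
  \<open>k - 1\<close>, and the two borders supply left and right kernel vectors on which the update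
  acts as \<open>x\<close>, which gives the missing dimension whenever \<open>x\<close> is
  nonzero.\<close>

lemma rank_one_update:
  assumes b: "linear_functional su b" and c: "linear_functional sv c"
    and col: "\<And>i j. i < k \<Longrightarrow> j < k \<Longrightarrow> w (p1 i) (q1 j) + b (p1 i) * g j = (if i = j then 1 else 0)"
    and row: "\<And>i j. i < k \<Longrightarrow> j < k \<Longrightarrow> w (p2 i) (q2 j) + f i * c (q2 j) = (if i = j then 1 else 0)"
  shows "\<exists>x0. \<forall>x. x \<noteq> 0 \<longrightarrow> x \<noteq> x0 \<longrightarrow> rank_ge k (\<lambda>u v. w u v + x * (b u * c v))"
proof (cases "rank_ge k w")
  case True
  note blin = linear_functionalD[OF b]
  obtain p q where pq: "\<And>i j. i < k \<Longrightarrow> j < k \<Longrightarrow> w (p i) (q j) = (if i = j then 1 else 0)"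
    using True unfolding rank_ge_def by blast
  define t where "t = (\<Sum>l<k. b (p l) * c (q l))"
  have "rank_ge k (\<lambda>u v. w u v + x * (b u * c v))" if "x \<noteq> - 1 / t" for x
  proof -
    have d: "1 + x * t \<noteq> 0"
    proof
      assume 0: "1 + x * t = 0"
      then have "t \<noteq> 0" by auto
      with 0 have "x = - 1 / t" by (simp add: field_simps eq_neg_iff_add_eq_0)
      with that show False by simp
    qed
    define S where "S = (\<Sum>l<k. su (c (q l)) (p l))"
    \<comment> \<open>Sherman-Morrison: the left vectors are multiplied by the inverse of the
      compressed update.\<close>
    define p' where "p' i = p i - su (x * b (p i) / (1 + x * t)) S" for i
    have bS: "b S = t" by (simp add: S_def t_def blin mult.commute)
    have wS: "w S (q j) = c (q j)" if "j < k" for j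
      using that by (simp add: S_def lin pq sum_mult_delta)
    have "w (p' i) (q j) + x * (b (p' i) * c (q j)) = (if i = j then 1 else 0)"
      if "i < k" "j < k" for i j
    proof -
      have "w (p' i) (q j) + x * (b (p' i) * c (q j))
        = w (p i) (q j) + c (q j) * x * b (p i) * (1 - 1 / (1 + x * t) - x * t / (1 + x * t))"
        by (simp add: p'_def lin blin wS that bS algebra_simps)
      also have "1 - 1 / (1 + x * t) - x * t / (1 + x * t) = 0"
        using d by (simp add: field_simps)
      finally show ?thesis using pq that by simp
    qed
    then show ?thesis unfolding rank_ge_def by blast
  qed
  then show ?thesis by blast
next
  case False
  note blin = linear_functionalD[OF b] and clin = linear_functionalD[OF c]
  obtain u where u: "b u = 1" "\<And>v. w u v = 0" using kernel_vector_left[OF False b col] by blast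
  obtain v where v: "c v = 1" "\<And>u. w u v = 0" using kernel_vector_right[OF False c row] by blast
  obtain r p q where r: "r < k"
    and pq: "\<And>i j. i < r \<Longrightarrow> j < r \<Longrightarrow> w (p i) (q j) = (if i = j then 1 else 0)"
    and fac: "\<And>u v. w u v = (\<Sum>l<r. w u (q l) * w (p l) v)"
    using rank_dichotomy[OF False] by blast
  \<comment> \<open>One border column raises the rank of \<open>w\<close> by at most one.\<close>
  have "k \<le> Suc r"
  proof (rule identity_factor)
    fix i j assume "i < k" "j < k"
    then have "(if i = j then 1 else 0) = w (p1 i) (q1 j) + b (p1 i) * g j" using col by simp
    also have "\<dots> = (\<Sum>l<Suc r. (if l < r then w (p1 i) (q l) else b (p1 i)) * (if l < r then w (p l) (q1 j) else g j))"
      by (subst fac) simp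
    finally show "(\<Sum>l<Suc r. (if l < r then w (p1 i) (q l) else b (p1 i)) * (if l < r then w (p l) (q1 j) else g j))
      = (if i = j then 1 else 0)" by simp
  qed
  with r have k: "k = Suc r" by simp
  have "rank_ge k (\<lambda>u v. w u v + x * (b u * c v))" if "x \<noteq> 0" for x
  proof -
    \<comment> \<open>Subtracting multiples of the kernel vectors \<open>u\<close> and
      \<open>v\<close> makes \<open>b\<close> and \<open>c\<close> vanish on the first
      \<open>r\<close> pairs without changing \<open>w\<close>. The last pair is
      \<open>u / x\<close> and \<open>v\<close>, on which only the update contributes.\<close>
    define p' where "p' i = (if i < r then p i - su (b (p i)) u else su (1 / x) u)" for i
    define q' where "q' j = (if j < r then q j - sv (c (q j)) v else v)" for j
    have "w (p' i) (q' j) + x * (b (p' i) * c (q' j)) = (if i = j then 1 else 0)"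
      if "i < k" "j < k" for i j
      using that \<open>x \<noteq> 0\<close> by (auto simp: k less_Suc_eq p'_def q'_def lin blin clin u v pq)
    then show ?thesis unfolding rank_ge_def by blast
  qed
  then show ?thesis by blast
qed

end

subsection \<open>Generic combinations of rank-one forms\<close>

text \<open>The form of the bordered matrix \<open>[w, b\<^sub>S; c\<^sub>T, 0]\<close>; the second components of the
  arguments are the coordinates along the border, and those outside \<open>S\<close> and \<open>T\<close> are ignored.\<close>
definition aug :: "'c set \<Rightarrow> 'd set \<Rightarrow> ('u \<Rightarrow> 'v \<Rightarrow> 'f::field) \<Rightarrow> ('c \<Rightarrow> 'u \<Rightarrow> 'f) \<Rightarrow> ('d \<Rightarrow> 'v \<Rightarrow> 'f)
    \<Rightarrow> 'u \<times> ('d \<Rightarrow> 'f) \<Rightarrow> 'v \<times> ('c \<Rightarrow> 'f) \<Rightarrow> 'f" where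
  "aug S T w b c U V = w (fst U) (fst V)
    + (\<Sum>k\<in>S. b k (fst U) * snd V k) + (\<Sum>k\<in>T. snd U k * c k (fst V))"

definition pair_scale :: "('f::field \<Rightarrow> 'u \<Rightarrow> 'u) \<Rightarrow> 'f \<Rightarrow> 'u \<times> ('d \<Rightarrow> 'f) \<Rightarrow> 'u \<times> ('d \<Rightarrow> 'f)" where
  "pair_scale s t U = (s t (fst U), \<lambda>k. t * snd U k)"

lemma linear_functional_aug_left:
  assumes "\<And>v. linear_functional su (\<lambda>u. w u v)" "\<And>k. linear_functional su (b k)"
  shows "linear_functional (pair_scale su) (\<lambda>U. aug S T w b c U V)"
  unfolding linear_functional_def aug_def pair_scale_def
  by (simp add: linear_functionalD[OF assms(1)] linear_functionalD[OF assms(2)]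
      sum.distrib sum_distrib_left algebra_simps)

lemma linear_functional_aug_right:
  assumes "\<And>u. linear_functional sv (w u)" "\<And>k. linear_functional sv (c k)"
  shows "linear_functional (pair_scale sv) (aug S T w b c U)"
  unfolding linear_functional_def aug_def pair_scale_def
  by (simp add: linear_functionalD[OF assms(1)] linear_functionalD[OF assms(2)]
      sum.distrib sum_distrib_left algebra_simps)

lemma linear_functional_fst:
  "linear_functional s f \<Longrightarrow> linear_functional (pair_scale s) (\<lambda>U. f (fst U))"
  by (simp add: linear_functional_def pair_scale_def)

lemma bilinear_form_aug:
  assumes "bilinear_form su sv w" "\<And>k. linear_functional su (b k)" "\<And>k. linear_functional sv (c k)"
  shows "bilinear_form (pair_scale su) (pair_scale sv) (aug S T w b c)"
  using assms by (intro bilinear_form.intro linear_functional_aug_left linear_functional_aug_right)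
    (auto simp: bilinear_form_def)

text \<open>Each subset \<open>s\<close> of \<open>J\<close> puts the column of every pair in
  \<open>s\<close> and the row of every other pair into the border. Adding a pair \<open>e\<close>
  to \<open>J\<close> doubles the subsets: \<open>e\<close> in \<open>s\<close> borders with its
  column, \<open>e\<close> outside \<open>s\<close> with its row, and these are the two hypotheses
  of \<open>rank_one_update\<close>. Every \<open>s\<close> excludes at most two coefficients, so an
  infinite \<open>X\<close> contains one that works for all \<open>s\<close> at once, and the
  updated form satisfies the induction hypothesis for \<open>J\<close>.\<close>

lemma generic_rank:
  fixes J :: "('c \<times> 'd) set" and w :: "'u::ab_group_add \<Rightarrow> 'v::ab_group_add \<Rightarrow> 'f::field"
  assumes "finite J" and X: "infinite X"
    and "bilinear_form su sv w"
    and b: "\<And>k. linear_functional su (b k)" and c: "\<And>k. linear_functional sv (c k)"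
    and "\<And>s. s \<subseteq> J \<Longrightarrow> rank_ge k (aug (fst ` s) (snd ` (J - s)) w b c)"
  shows "\<exists>x. (\<forall>j\<in>J. x j \<in> X)
    \<and> rank_ge k (\<lambda>u v. w u v + (\<Sum>j\<in>J. x j * (b (fst j) u * c (snd j) v)))"
  using assms(1,3,6)
proof (induction J arbitrary: w rule: finite_induct)
  case empty
  obtain p q where "\<And>i j. i < k \<Longrightarrow> j < k \<Longrightarrow> aug {} {} w b c (p i) (q j) = (if i = j then 1 else 0)"
    using empty(2)[of "{}"] unfolding rank_ge_def by auto
  then have "rank_ge k w"
    unfolding rank_ge_def aug_def by (intro exI[of _ "fst \<circ> p"] exI[of _ "fst \<circ> q"]) simp
  then show ?case by simp
next
  case (insert e J)
  interpret bilinear_form su sv w by fact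
  define b' where "b' U = b (fst e) (fst U)" for U :: "'u \<times> ('d \<Rightarrow> 'f)"
  define c' where "c' V = c (snd e) (fst V)" for V :: "'v \<times> ('c \<Rightarrow> 'f)"
  define good where "good s x \<longleftrightarrow>
    rank_ge k (\<lambda>U V. aug (fst ` s) (snd ` (J - s)) w b c U V + x * (b' U * c' V))" for s x
  have "\<exists>x0. \<forall>x. x \<noteq> 0 \<longrightarrow> x \<noteq> x0 \<longrightarrow> good s x"
    if s: "s \<subseteq> J" for s
  proof -
    interpret A: bilinear_form "pair_scale su" "pair_scale sv" "aug (fst ` s) (snd ` (J - s)) w b c"
      by (rule bilinear_form_aug[OF insert.prems(1) b c])
    have fin: "finite (fst ` s)" "finite (snd ` (J - s))"
      using s insert.hyps(1) finite_subset by auto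
    have "fst ` insert e s = insert (fst e) (fst ` s)" "insert e J - insert e s = J - s"
      using insert.hyps(2) by auto
    then have "rank_ge k (aug (insert (fst e) (fst ` s)) (snd ` (J - s)) w b c)"
      using insert.prems(2)[of "insert e s"] s by auto
    then obtain p1 q1 where 1: "\<And>i j. i < k \<Longrightarrow> j < k \<Longrightarrow>
        aug (insert (fst e) (fst ` s)) (snd ` (J - s)) w b c (p1 i) (q1 j) = (if i = j then 1 else 0)"
      unfolding rank_ge_def by blast
    \<comment> \<open>If the column of \<open>e\<close> already belongs to the border through
      another pair, inserting it adds nothing, and weight 0 is correct.\<close>
    define g where "g j = (if fst e \<in> fst ` s then 0 else snd (q1 j) (fst e))" for j
    have col: "aug (fst ` s) (snd ` (J - s)) w b c (p1 i) (q1 j) + b' (p1 i) * g j = (if i = j then 1 else 0)"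
      if "i < k" "j < k" for i j
      using 1[OF that] fin
      by (cases "fst e \<in> fst ` s") (simp_all add: aug_def g_def b'_def insert_absorb algebra_simps)
    have "snd ` (insert e J - s) = insert (snd e) (snd ` (J - s))"
      using insert.hyps(2) s by auto
    then have "rank_ge k (aug (fst ` s) (insert (snd e) (snd ` (J - s))) w b c)"
      using insert.prems(2)[of s] s by auto
    then obtain p2 q2 where 2: "\<And>i j. i < k \<Longrightarrow> j < k \<Longrightarrow>
        aug (fst ` s) (insert (snd e) (snd ` (J - s))) w b c (p2 i) (q2 j) = (if i = j then 1 else 0)"
      unfolding rank_ge_def by blast
    define f where "f i = (if snd e \<in> snd ` (J - s) then 0 else snd (p2 i) (snd e))" for i
    have row: "aug (fst ` s) (snd ` (J - s)) w b c (p2 i) (q2 j) + f i * c' (q2 j) = (if i = j then 1 else 0)"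
      if "i < k" "j < k" for i j
      using 2[OF that] fin
      by (cases "snd e \<in> snd ` (J - s)") (simp_all add: aug_def f_def c'_def insert_absorb algebra_simps)
    show ?thesis unfolding good_def
      by (rule A.rank_one_update[OF _ _ col row])
        (simp_all add: b'_def[abs_def] c'_def[abs_def] linear_functional_fst b c)
  qed
  then have "\<forall>s\<in>Pow J. \<exists>x0. \<forall>x. x \<noteq> 0 \<longrightarrow> x \<noteq> x0 \<longrightarrow> good s x" by blast
  from bchoice[OF this] obtain x0 where x0: "\<And>s x. s \<subseteq> J \<Longrightarrow> x \<noteq> 0 \<Longrightarrow> x \<noteq> x0 s \<Longrightarrow> good s x"
    by blast
  have "finite (insert 0 (x0 ` Pow J))" using insert.hyps(1) by simp
  then obtain y where y: "y \<in> X" "y \<notin> insert 0 (x0 ` Pow J)"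
    using X by (meson finite_subset subsetI)
  define w' where "w' u v = w u v + y * (b (fst e) u * c (snd e) v)" for u v
  have bw': "bilinear_form su sv w'"
    by unfold_locales (simp_all add: w'_def linear_functional_def lin linear_functionalD[OF b]
        linear_functionalD[OF c] algebra_simps)
  have "rank_ge k (aug (fst ` s) (snd ` (J - s)) w' b c)" if "s \<subseteq> J" for s
  proof -
    have "aug (fst ` s) (snd ` (J - s)) w' b c
      = (\<lambda>U V. aug (fst ` s) (snd ` (J - s)) w b c U V + y * (b' U * c' V))"
      by (intro ext) (simp add: aug_def w'_def b'_def c'_def)
    then show ?thesis using x0[OF that, of y] y that by (auto simp: good_def)
  qed
  from insert.IH[OF bw' this] obtain x where x: "\<And>j. j \<in> J \<Longrightarrow> x j \<in> X"
    "rank_ge k (\<lambda>u v. w' u v + (\<Sum>j\<in>J. x j * (b (fst j) u * c (snd j) v)))" by blast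
  have "(\<Sum>j\<in>insert e J. (x(e := y)) j * (b (fst j) u * c (snd j) v))
      = y * (b (fst e) u * c (snd e) v) + (\<Sum>j\<in>J. x j * (b (fst j) u * c (snd j) v))" for u v
  proof -
    have "(\<Sum>j\<in>J. (x(e := y)) j * (b (fst j) u * c (snd j) v)) = (\<Sum>j\<in>J. x j * (b (fst j) u * c (snd j) v))"
      using insert.hyps(2) by (intro sum.cong) auto
    then show ?thesis using insert.hyps by simp
  qed
  then have "rank_ge k (\<lambda>u v. w u v + (\<Sum>j\<in>insert e J. (x(e := y)) j * (b (fst j) u * c (snd j) v)))"
    using x(2) by (simp add: w'_def add.assoc)
  moreover have "\<forall>j\<in>insert e J. (x(e := y)) j \<in> X" using x(1) y(1) by auto
  ultimately show ?case by blast
qed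

section \<open>Spans of border functionals\<close>

definition lspan :: "'c set \<Rightarrow> ('c \<Rightarrow> 'u \<Rightarrow> 'f::field) \<Rightarrow> ('u \<Rightarrow> 'f) set" where
  "lspan S b = {\<phi>. \<exists>g. \<phi> = (\<lambda>u. \<Sum>k\<in>S. g k * b k u)}"

lemma lspan_zero: "(\<lambda>_. 0) \<in> lspan S b"
  unfolding lspan_def by (intro CollectI exI[of _ "\<lambda>_. 0"]) simp

lemma lspan_scale:
  assumes "\<phi> \<in> lspan S b"
  shows "(\<lambda>u. t * \<phi> u) \<in> lspan S b"
proof -
  obtain g where "\<phi> = (\<lambda>u. \<Sum>k\<in>S. g k * b k u)" using assms by (auto simp: lspan_def)
  then show ?thesis unfolding lspan_def
    by (intro CollectI exI[of _ "\<lambda>k. t * g k"]) (simp add: sum_distrib_left mult.assoc)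
qed

lemma lspan_add:
  assumes "\<phi> \<in> lspan S b" "\<psi> \<in> lspan S b"
  shows "(\<lambda>u. \<phi> u + \<psi> u) \<in> lspan S b"
proof -
  obtain g h where "\<phi> = (\<lambda>u. \<Sum>k\<in>S. g k * b k u)" "\<psi> = (\<lambda>u. \<Sum>k\<in>S. h k * b k u)"
    using assms by (auto simp: lspan_def)
  then show ?thesis unfolding lspan_def
    by (intro CollectI exI[of _ "\<lambda>k. g k + h k"]) (simp add: sum.distrib ring_distribs)
qed

lemma lspan_sum:
  assumes "\<And>l. l \<in> L \<Longrightarrow> \<phi> l \<in> lspan S b"
  shows "(\<lambda>u. \<Sum>l\<in>L. \<phi> l u) \<in> lspan S b"
  using assms
proof (induction L rule: infinite_finite_induct)
  case (insert l L)
  then show ?case using lspan_add[of "\<phi> l" S b "\<lambda>u. \<Sum>l\<in>L. \<phi> l u"] by simp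
qed (simp_all add: lspan_zero)

lemma lspan_base:
  assumes "finite S" "k \<in> S"
  shows "b k \<in> lspan S b"
proof -
  have "(\<Sum>l\<in>S. (if l = k then 1 else 0) * b l u) = b k u" for u
    using assms by (simp add: if_distrib if_distribR cong: if_cong)
  then show ?thesis unfolding lspan_def
    by (intro CollectI exI[of _ "\<lambda>l. if l = k then 1 else 0"]) auto
qed

lemma lspan_mono:
  assumes "finite S" "\<phi> \<in> lspan S' b'" "S' \<subseteq> S" "\<And>k. k \<in> S' \<Longrightarrow> b' k = b k"
  shows "\<phi> \<in> lspan S b"
proof -
  obtain g where g: "\<phi> = (\<lambda>u. \<Sum>k\<in>S'. g k * b' k u)" using assms(2) by (auto simp: lspan_def)
  have "(\<lambda>u. \<Sum>k\<in>S'. g k * b k u) \<in> lspan S b"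
    using assms(1,3) by (intro lspan_sum lspan_scale lspan_base) auto
  then show ?thesis using g assms(4) by simp
qed

lemma lspan_cong:
  assumes "\<phi> \<in> lspan S b" "\<And>k. k \<in> S \<Longrightarrow> b k u = b k u'"
  shows "\<phi> u = \<phi> u'"
  using assms by (auto simp: lspan_def)

text \<open>Lets a rank be certified over any finite index set \<open>K\<close>, with span elements
  as border contributions: their coefficients become the border coordinates of the arguments of
  \<open>aug\<close>.\<close>

lemma rank_ge_augI:
  assumes "finite K" "k \<le> card K"
    and \<beta>: "\<And>j. j \<in> K \<Longrightarrow> \<beta> j \<in> lspan S b" and \<gamma>: "\<And>i. i \<in> K \<Longrightarrow> \<gamma> i \<in> lspan T c"
    and id: "\<And>i j. i \<in> K \<Longrightarrow> j \<in> K \<Longrightarrow>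
      w (p i) (q j) + \<beta> j (p i) + \<gamma> i (q j) = (if i = j then 1 else 0)"
  shows "rank_ge k (aug S T w b c)"
proof -
  obtain h where h: "bij_betw h {0..<card K} K" using ex_bij_betw_nat_finite assms(1) by blast
  have hK: "h i \<in> K" if "i < k" for i using h that assms(2) by (auto simp: bij_betw_def)
  have inj: "h i = h j \<longleftrightarrow> i = j" if "i < k" "j < k" for i j
    using h that assms(2) by (auto simp: bij_betw_def inj_on_def)
  obtain g where g: "\<And>j. j \<in> K \<Longrightarrow> \<beta> j = (\<lambda>u. \<Sum>k\<in>S. g j k * b k u)"
    using \<beta> unfolding lspan_def by simp metis
  obtain f where f: "\<And>j. j \<in> K \<Longrightarrow> \<gamma> j = (\<lambda>u. \<Sum>k\<in>T. f j k * c k u)"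
    using \<gamma> unfolding lspan_def by simp metis
  have "aug S T w b c (p (h i), f (h i)) (q (h j), g (h j)) = (if i = j then 1 else 0)"
    if "i < k" "j < k" for i j
  proof -
    have "aug S T w b c (p (h i), f (h i)) (q (h j), g (h j))
        = w (p (h i)) (q (h j)) + \<beta> (h j) (p (h i)) + \<gamma> (h i) (q (h j))"
      using hK that by (simp add: aug_def f g mult.commute)
    then show ?thesis using id[OF hK hK] inj that by simp
  qed
  then show ?thesis unfolding rank_ge_def
    by (intro exI[of _ "\<lambda>i. (p (h i), f (h i))"] exI[of _ "\<lambda>j. (q (h j), g (h j))"]) blast
qed

subsection \<open>Rank of matrices\<close>

text \<open>The form \<open>u^T M v\<close>; vectors are functions on all naturals, and values
  beyond the dimensions of \<open>M\<close> are ignored.\<close>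

definition mform :: "'f::field mat \<Rightarrow> (nat \<Rightarrow> 'f) \<Rightarrow> (nat \<Rightarrow> 'f) \<Rightarrow> 'f" where
  "mform M u v = (\<Sum>i<dim_row M. \<Sum>j<dim_col M. u i * M $$ (i, j) * v j)"

definition fun_scale :: "'f::field \<Rightarrow> (nat \<Rightarrow> 'f) \<Rightarrow> nat \<Rightarrow> 'f" where
  "fun_scale t u = (\<lambda>i. t * u i)"

lemma bilinear_mform: "bilinear_form fun_scale fun_scale (mform M)"
  by unfold_locales
    (simp_all add: linear_functional_def mform_def fun_scale_def algebra_simps sum.distrib sum_distrib_left)

lemma mform_unit:
  assumes "a < dim_row M" "b < dim_col M"
  shows "mform M (\<lambda>i. if i = a then 1 else 0) (\<lambda>j. if j = b then 1 else 0) = M $$ (a, b)"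
proof -
  have "mform M (\<lambda>i. if i = a then 1 else 0) (\<lambda>j. if j = b then 1 else 0)
    = (\<Sum>i<dim_row M. (if i = a then 1 else 0) * (\<Sum>j<dim_col M. M $$ (i, j) * (if j = b then 1 else 0)))"
    by (simp add: mform_def sum_distrib_left mult.assoc)
  also have "\<dots> = M $$ (a, b)" using assms by (simp add: sum_mult_delta)
  finally show ?thesis .
qed

lemma low_rank_factorization:
  fixes M :: "'f::field mat"
  assumes "\<not> rank_ge k (mform M)"
  obtains r X Y where "r < k"
    "\<And>a b. a < dim_row M \<Longrightarrow> b < dim_col M \<Longrightarrow> M $$ (a, b) = (\<Sum>l<r. X a l * Y l b)"
proof -
  interpret bilinear_form fun_scale fun_scale "mform M" by (rule bilinear_mform)
  obtain r p q where r: "r < k" and f: "\<And>u v. mform M u v = (\<Sum>l<r. mform M u (q l) * mform M (p l) v)"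
    using rank_dichotomy[OF assms] by blast
  define X where "X a l = mform M (\<lambda>i. if i = a then 1 else 0) (q l)" for a l
  define Y where "Y l b = mform M (p l) (\<lambda>j. if j = b then 1 else 0)" for l b
  have "M $$ (a, b) = (\<Sum>l<r. X a l * Y l b)" if "a < dim_row M" "b < dim_col M" for a b
    unfolding X_def Y_def f[symmetric] mform_unit[OF that] ..
  with r show ?thesis using that by blast
qed

text \<open>Deficient row rank gives a factorization through fewer dimensions than there are rows,
  so the left factor has a left kernel vector.\<close>

lemma left_kernel_exists:
  fixes M :: "'f::field mat"
  assumes "\<not> rank_ge (dim_row M) (mform M)"
  shows "\<exists>u. (\<exists>a<dim_row M. u a \<noteq> 0) \<and> (\<forall>b<dim_col M. (\<Sum>a<dim_row M. u a * M $$ (a, b)) = 0)"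
proof -
  obtain r X Y where r: "r < dim_row M"
    and f: "\<And>a b. a < dim_row M \<Longrightarrow> b < dim_col M \<Longrightarrow> M $$ (a, b) = (\<Sum>l<r. X a l * Y l b)"
    using low_rank_factorization[OF assms] by blast
  obtain u where u: "\<exists>a<dim_row M. u a \<noteq> 0" "\<And>l. l < r \<Longrightarrow> (\<Sum>a<dim_row M. X a l * u a) = 0"
    using wide_kernel[OF r, of "\<lambda>l a. X a l"] by blast
  have "(\<Sum>a<dim_row M. u a * M $$ (a, b)) = 0" if "b < dim_col M" for b
  proof -
    have "(\<Sum>a<dim_row M. u a * M $$ (a, b)) = (\<Sum>a<dim_row M. \<Sum>l<r. Y l b * (X a l * u a))"
      using that by (simp add: f sum_distrib_left ac_simps)
    also have "\<dots> = (\<Sum>l<r. Y l b * (\<Sum>a<dim_row M. X a l * u a))"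
      by (subst sum.swap) (simp add: sum_distrib_left)
    finally show ?thesis using u(2) by simp
  qed
  with u(1) show ?thesis by blast
qed

lemma right_kernel_exists:
  fixes M :: "'f::field mat"
  assumes "\<not> rank_ge (dim_col M) (mform M)"
  shows "\<exists>v. (\<exists>b<dim_col M. v b \<noteq> 0) \<and> (\<forall>a<dim_row M. (\<Sum>b<dim_col M. M $$ (a, b) * v b) = 0)"
proof -
  obtain r X Y where r: "r < dim_col M"
    and f: "\<And>a b. a < dim_row M \<Longrightarrow> b < dim_col M \<Longrightarrow> M $$ (a, b) = (\<Sum>l<r. X a l * Y l b)"
    using low_rank_factorization[OF assms] by blast
  obtain v where v: "\<exists>b<dim_col M. v b \<noteq> 0" "\<And>l. l < r \<Longrightarrow> (\<Sum>b<dim_col M. Y l b * v b) = 0"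
    using wide_kernel[OF r, of Y] by blast
  have "(\<Sum>b<dim_col M. M $$ (a, b) * v b) = 0" if "a < dim_row M" for a
  proof -
    have "(\<Sum>b<dim_col M. M $$ (a, b) * v b) = (\<Sum>b<dim_col M. \<Sum>l<r. X a l * (Y l b * v b))"
      using that by (simp add: f sum_distrib_left sum_distrib_right ac_simps)
    also have "\<dots> = (\<Sum>l<r. X a l * (\<Sum>b<dim_col M. Y l b * v b))"
      by (subst sum.swap) (simp add: sum_distrib_left)
    finally show ?thesis using v(2) by simp
  qed
  with v(1) show ?thesis by blast
qed

text \<open>Links the column rank to compressions. If \<open>M\<close> factored through
  \<open>r < k\<close> dimensions, then among the at least \<open>k\<close> columns of a maximal
  independent set the corresponding columns of \<open>Y\<close> would be dependent, and the same
  combination would annihilate the columns of \<open>M\<close>.\<close>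

lemma rank_ge_mrank:
  fixes M :: "'f::field mat"
  assumes "k \<le> mrank M"
  shows "rank_ge k (mform M)"
proof (rule ccontr)
  assume "\<not> ?thesis"
  then obtain r X Y where r: "r < k"
    and f: "\<And>a b. a < dim_row M \<Longrightarrow> b < dim_col M \<Longrightarrow> M $$ (a, b) = (\<Sum>l<r. X a l * Y l b)"
    using low_rank_factorization by blast
  define n where "n = dim_row M"
  interpret vec_space "TYPE('f)" n .
  have M: "M \<in> carrier_mat n (dim_col M)" by (simp add: n_def)
  obtain S where S: "maximal S (\<lambda>T. T \<subseteq> set (cols M) \<and> lin_indpt T)"
    using maximal_exists[of "\<lambda>T. T \<subseteq> set (cols M) \<and> lin_indpt T" "card (set (cols M))" "{}"]
    by (meson List.finite_set card_mono empty_iff empty_subsetI finite_lin_indpt2 rev_finite_subset)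
  then have Sc: "S \<subseteq> set (cols M)" "lin_indpt S" by (auto simp: maximal_def)
  have "card S = mrank M" using rank_card_indpt[OF M S] by (simp add: mrank_def n_def)
  then have rS: "r < card S" using r assms by simp
  obtain xs where xs: "set xs = S" "distinct xs"
    using finite_distinct_list[of S] Sc(1) finite_subset by auto
  then have len: "length xs = card S" using distinct_card by fastforce
  define W where "W = mat_of_cols n xs"
  have "set xs \<subseteq> carrier_vec n" using xs(1) Sc(1) cols_dim[of M] unfolding n_def by blast
  then have cW: "cols W = xs" by (simp add: W_def)
  have W: "W \<in> carrier_mat n (card S)" by (simp add: W_def len[symmetric])
  have "\<exists>c<dim_col M. xs ! t = col M c" if "t < card S" for t
  proof -
    have "xs ! t \<in> set (cols M)" using that len xs(1) Sc(1) nth_mem by fastforce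
    then show ?thesis by (auto simp: cols_def)
  qed
  \<comment> \<open>\<open>idx\<close> records where the selected independent columns stand in
    \<open>M\<close>, so that the matching columns of \<open>Y\<close> can be taken.\<close>
  then obtain idx where idx: "\<And>t. t < card S \<Longrightarrow> idx t < dim_col M \<and> xs ! t = col M (idx t)" by metis
  obtain v where v: "\<exists>t<card S. v t \<noteq> 0" "\<And>l. l < r \<Longrightarrow> (\<Sum>t<card S. Y l (idx t) * v t) = 0"
    using wide_kernel[OF rS, of "\<lambda>l t. Y l (idx t)"] by blast
  have "W *\<^sub>v vec (card S) v = 0\<^sub>v n"
  proof (rule eq_vecI)
    fix a assume "a < dim_vec (0\<^sub>v n :: 'f vec)"
    then have a: "a < n" by simp
    have "(W *\<^sub>v vec (card S) v) $ a = (\<Sum>t<card S. W $$ (a, t) * v t)"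
      using W a by (auto simp: scalar_prod_def atLeast0LessThan)
    also have "\<dots> = (\<Sum>t<card S. \<Sum>l<r. X a l * (Y l (idx t) * v t))"
      using a idx len by (intro sum.cong) (auto simp: W_def mat_of_cols_index f n_def sum_distrib_right mult.assoc)
    also have "\<dots> = (\<Sum>l<r. X a l * (\<Sum>t<card S. Y l (idx t) * v t))"
      by (subst sum.swap) (simp add: sum_distrib_left)
    finally show "(W *\<^sub>v vec (card S) v) $ a = 0\<^sub>v n $ a" using v(2) a by simp
  qed (use W in simp)
  moreover have "vec (card S) v \<noteq> 0\<^sub>v (card S)" using v(1) by (metis index_vec index_zero_vec(1))
  ultimately have "lin_dep (set (cols W))"
    using lin_depI[OF W, of "vec (card S) v"] xs(2) cW by simp
  with Sc(2) cW xs(1) show False by simp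
qed

lemma square_inverse_commute:
  fixes P R :: "nat \<Rightarrow> nat \<Rightarrow> 'f::field"
  assumes "\<And>i j. i < n \<Longrightarrow> j < n \<Longrightarrow> (\<Sum>a<n. P i a * R a j) = (if i = j then 1 else 0)"
    and "i < n" "j < n"
  shows "(\<Sum>a<n. R i a * P a j) = (if i = j then 1 else 0)"
proof -
  define P' R' where "P' = mat n n (\<lambda>(i, j). P i j)" and "R' = mat n n (\<lambda>(i, j). R i j)"
  have c: "P' \<in> carrier_mat n n" "R' \<in> carrier_mat n n" by (simp_all add: P'_def R'_def)
  have "P' * R' = 1\<^sub>m n"
    using assms(1) by (intro eq_matI) (auto simp: P'_def R'_def scalar_prod_def atLeast0LessThan)
  then have "R' * P' = 1\<^sub>m n" using mat_mult_left_right_inverse c by blast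
  then have "(R' * P') $$ (i, j) = 1\<^sub>m n $$ (i, j)" by simp
  then show ?thesis
    using assms(2,3) by (simp add: P'_def R'_def scalar_prod_def atLeast0LessThan)
qed

text \<open>Full row rank gives a square product \<open>P (M Q) = 1\<close>, hence also
  \<open>(M Q) P = 1\<close>, and \<open>u = (u M) Q P\<close> vanishes with
  \<open>u M\<close>.\<close>

lemma left_kernel_trivial:
  fixes M :: "'f::field mat"
  assumes "rank_ge (dim_row M) (mform M)"
    and "\<And>b. b < dim_col M \<Longrightarrow> (\<Sum>a<dim_row M. u a * M $$ (a, b)) = 0" and "e < dim_row M"
  shows "u e = 0"
proof -
  define n where "n = dim_row M"
  obtain p q where pq: "\<And>i j. i < n \<Longrightarrow> j < n \<Longrightarrow> mform M (p i) (q j) = (if i = j then 1 else 0)"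
    using assms(1) unfolding rank_ge_def n_def by blast
  define R where "R a j = (\<Sum>b<dim_col M. M $$ (a, b) * q j b)" for a j
  have "(\<Sum>a<n. p i a * R a j) = (if i = j then 1 else 0)" if "i < n" "j < n" for i j
    using pq[OF that] by (simp add: mform_def R_def n_def sum_distrib_left mult.assoc)
  then have Rp: "(\<Sum>j<n. R a j * p j e) = (if a = e then 1 else 0)" if "a < n" for a
    using square_inverse_commute[of n p R a e] that assms(3) n_def by blast
  have uR: "(\<Sum>a<n. u a * R a j) = 0" for j
  proof -
    have "(\<Sum>a<n. u a * R a j) = (\<Sum>b<dim_col M. (\<Sum>a<n. u a * M $$ (a, b)) * q j b)"
      unfolding R_def sum_distrib_left sum_distrib_right by (subst sum.swap) (simp add: mult.assoc)
    then show ?thesis using assms(2) by (simp add: n_def)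
  qed
  have "u e = (\<Sum>a<n. u a * (\<Sum>j<n. R a j * p j e))"
    using assms(3) Rp by (simp add: sum_mult_delta n_def)
  also have "\<dots> = (\<Sum>j<n. (\<Sum>a<n. u a * R a j) * p j e)"
    unfolding sum_distrib_left sum_distrib_right by (subst sum.swap) (simp add: mult.assoc)
  finally show ?thesis using uR by simp
qed

lemma right_kernel_trivial:
  fixes M :: "'f::field mat"
  assumes "rank_ge (dim_col M) (mform M)"
    and "\<And>a. a < dim_row M \<Longrightarrow> (\<Sum>b<dim_col M. M $$ (a, b) * v b) = 0" and "e < dim_col M"
  shows "v e = 0"
proof -
  define n where "n = dim_col M"
  obtain p q where pq: "\<And>i j. i < n \<Longrightarrow> j < n \<Longrightarrow> mform M (p i) (q j) = (if i = j then 1 else 0)"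
    using assms(1) unfolding rank_ge_def n_def by blast
  define L where "L i b = (\<Sum>a<dim_row M. p i a * M $$ (a, b))" for i b
  have "(\<Sum>b<n. L i b * q j b) = (if i = j then 1 else 0)" if "i < n" "j < n" for i j
    using pq[OF that] unfolding mform_def L_def n_def sum_distrib_right
    by (subst sum.swap) (simp add: mult.assoc)
  then have qL: "(\<Sum>i<n. q i e * L i b) = (if e = b then 1 else 0)" if "b < n" for b
    using square_inverse_commute[of n L "\<lambda>b j. q j b" e b] that assms(3) n_def by simp
  have Lv: "(\<Sum>b<n. L i b * v b) = 0" for i
  proof -
    have "(\<Sum>b<n. L i b * v b) = (\<Sum>a<dim_row M. p i a * (\<Sum>b<n. M $$ (a, b) * v b))"
      unfolding L_def sum_distrib_left sum_distrib_right by (subst sum.swap) (simp add: mult.assoc)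
    then show ?thesis using assms(2) by (simp add: n_def)
  qed
  have "v e = (\<Sum>b<n. (\<Sum>i<n. q i e * L i b) * v b)"
    using assms(3) qL by (simp add: sum_mult_delta n_def)
  also have "\<dots> = (\<Sum>i<n. q i e * (\<Sum>b<n. L i b * v b))"
    unfolding sum_distrib_left sum_distrib_right by (subst sum.swap) (simp add: mult.assoc)
  finally show ?thesis using Lv by simp
qed

section \<open>Block sums and entries of concatenated matrices\<close>

lemma sum_lessThan_add:
  fixes f :: "nat \<Rightarrow> 'a::comm_monoid_add"
  shows "(\<Sum>i<n + d. f i) = (\<Sum>i<n. f i) + (\<Sum>i<d. f (n + i))"
  by (induction d) (simp_all add: add.assoc)

lemma mult_mat_entry:
  assumes "M \<in> carrier_mat n d" "L \<in> carrier_mat d c" "i < n" "j < c"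
  shows "(M * L) $$ (i, j) = (\<Sum>l<d. M $$ (i, l) * L $$ (l, j))"
  using assms by (simp add: scalar_prod_def atLeast0LessThan)

lemma dim_hcat: "dim_row (hcat r M s) = r" and dim_vcat: "dim_col (vcat r M s) = r"
  by (simp_all add: hcat_def vcat_def)

lemma cols_hcat:
  assumes "finite s" "\<And>i. i \<in> s \<Longrightarrow> dim_row (M i) = r"
  shows "set (cols (hcat r M s)) = (\<Union>i\<in>s. set (cols (M i)))"
proof -
  have "set (concat (map (\<lambda>i. cols (M i)) (sorted_list_of_set s))) = (\<Union>i\<in>s. set (cols (M i)))"
    using assms(1) by simp
  moreover have "(\<Union>i\<in>s. set (cols (M i))) \<subseteq> carrier_vec r"
    using assms(2) cols_dim by blast
  ultimately show ?thesis unfolding hcat_def by (simp add: cols_mat_of_cols)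
qed

lemma rows_vcat:
  assumes "finite s" "\<And>i. i \<in> s \<Longrightarrow> dim_col (M i) = r"
  shows "set (rows (vcat r M s)) = (\<Union>i\<in>s. set (rows (M i)))"
proof -
  have "set (concat (map (\<lambda>i. rows (M i)) (sorted_list_of_set s))) = (\<Union>i\<in>s. set (rows (M i)))"
    using assms(1) by simp
  moreover have "(\<Union>i\<in>s. set (rows (M i))) \<subseteq> carrier_vec r"
    using assms(2) rows_carrier by blast
  ultimately show ?thesis unfolding vcat_def by (simp add: rows_mat_of_rows)
qed

lemma mem_cols_iff: "v \<in> set (cols M) \<longleftrightarrow> (\<exists>l<dim_col M. v = col M l)"
  by (auto simp: cols_def)

lemma mem_rows_iff: "v \<in> set (rows M) \<longleftrightarrow> (\<exists>l<dim_row M. v = row M l)"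
  by (auto simp: rows_def)

text \<open>Only spans of columns matter later, so it suffices to know which block a column comes
  from; its position in the concatenation is never computed.\<close>

lemma hcat_entry:
  assumes "finite s" "\<And>i. i \<in> s \<Longrightarrow> dim_row (M i) = r" "l < dim_col (hcat r M s)"
  obtains i c where "i \<in> s" "c < dim_col (M i)" "\<And>a. a < r \<Longrightarrow> hcat r M s $$ (a, l) = M i $$ (a, c)"
proof -
  have "col (hcat r M s) l \<in> set (cols (hcat r M s))" using assms(3) by (auto simp: mem_cols_iff)
  then obtain i c where ic: "i \<in> s" "c < dim_col (M i)" "col (hcat r M s) l = col (M i) c"
    using cols_hcat[of s M r] assms(1,2) by (auto simp: mem_cols_iff)
  have "hcat r M s $$ (a, l) = M i $$ (a, c)" if "a < r" for a
    using arg_cong[OF ic(3), of "\<lambda>v. v $ a"] ic(1,2) assms that by (simp add: dim_hcat)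
  with ic that show ?thesis by blast
qed

lemma hcat_entry_ex:
  assumes "finite s" "\<And>i. i \<in> s \<Longrightarrow> dim_row (M i) = r" "i \<in> s" "c < dim_col (M i)"
  obtains l where "l < dim_col (hcat r M s)" "\<And>a. a < r \<Longrightarrow> hcat r M s $$ (a, l) = M i $$ (a, c)"
proof -
  have "col (M i) c \<in> set (cols (hcat r M s))"
    using cols_hcat[of s M r] assms by (auto simp: mem_cols_iff)
  then obtain l where l: "l < dim_col (hcat r M s)" "col (M i) c = col (hcat r M s) l"
    by (auto simp: mem_cols_iff)
  have "hcat r M s $$ (a, l) = M i $$ (a, c)" if "a < r" for a
    using arg_cong[OF l(2), of "\<lambda>v. v $ a"] l(1) assms that by (simp add: dim_hcat)
  with l that show ?thesis by blast
qed

lemma vcat_entry: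
  assumes "finite s" "\<And>i. i \<in> s \<Longrightarrow> dim_col (M i) = r" "l < dim_row (vcat r M s)"
  obtains i c where "i \<in> s" "c < dim_row (M i)" "\<And>b. b < r \<Longrightarrow> vcat r M s $$ (l, b) = M i $$ (c, b)"
proof -
  have "row (vcat r M s) l \<in> set (rows (vcat r M s))" using assms(3) by (auto simp: mem_rows_iff)
  then obtain i c where ic: "i \<in> s" "c < dim_row (M i)" "row (vcat r M s) l = row (M i) c"
    using rows_vcat[of s M r] assms(1,2) by (auto simp: mem_rows_iff)
  have "vcat r M s $$ (l, b) = M i $$ (c, b)" if "b < r" for b
    using arg_cong[OF ic(3), of "\<lambda>v. v $ b"] ic(1,2) assms that by (simp add: dim_vcat)
  with ic that show ?thesis by blast
qed

subsection \<open>The Popov-Belevitch-Hautus matrix\<close>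

definition shift_mat :: "real mat \<Rightarrow> complex \<Rightarrow> complex mat" where
  "shift_mat A lam = lam \<cdot>\<^sub>m 1\<^sub>m (dim_row A) - map_mat complex_of_real A"

lemma shift_mat_dim:
  "dim_row (shift_mat A lam) = dim_row A" "dim_col (shift_mat A lam) = dim_col A"
  by (simp_all add: shift_mat_def)

lemma shift_mat_entry:
  assumes "a < dim_row A" "b < dim_col A" "dim_row A = dim_col A"
  shows "shift_mat A lam $$ (a, b) = (if a = b then lam else 0) - of_real (A $$ (a, b))"
  using assms by (simp add: shift_mat_def)

lemma shift_mat_right_kernel:
  assumes "A \<in> carrier_mat n n" "a < n"
  shows "(\<Sum>b<n. shift_mat A lam $$ (a, b) * v b) = lam * v a - (\<Sum>b<n. of_real (A $$ (a, b)) * v b)"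
proof -
  have "(\<Sum>b<n. shift_mat A lam $$ (a, b) * v b)
      = (\<Sum>b<n. lam * ((if a = b then 1 else 0) * v b) - of_real (A $$ (a, b)) * v b)"
    using assms by (intro sum.cong) (auto simp: shift_mat_entry algebra_simps)
  also have "\<dots> = lam * v a - (\<Sum>b<n. of_real (A $$ (a, b)) * v b)"
    using assms(2) unfolding sum_subtractf sum_distrib_left[symmetric] by (simp add: sum_mult_delta)
  finally show ?thesis .
qed

lemma shift_mat_left_kernel:
  assumes "A \<in> carrier_mat n n" "b < n"
  shows "(\<Sum>a<n. u a * shift_mat A lam $$ (a, b)) = lam * u b - (\<Sum>a<n. u a * of_real (A $$ (a, b)))"
proof -
  have "(\<Sum>a<n. u a * shift_mat A lam $$ (a, b))
      = (\<Sum>a<n. lam * (u a * (if a = b then 1 else 0)) - u a * of_real (A $$ (a, b)))"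
    using assms by (intro sum.cong) (auto simp: shift_mat_entry algebra_simps)
  also have "\<dots> = lam * u b - (\<Sum>a<n. u a * of_real (A $$ (a, b)))"
    using assms(2) unfolding sum_subtractf sum_distrib_left[symmetric] by (simp add: sum_mult_delta)
  finally show ?thesis .
qed

lemma eigenvalue_iff_shift_kernel:
  assumes A: "A \<in> carrier_mat n n"
  shows "eigenvalue (map_mat complex_of_real A) lam \<longleftrightarrow>
    (\<exists>v. (\<exists>b<n. v b \<noteq> 0) \<and> (\<forall>a<n. (\<Sum>b<n. shift_mat A lam $$ (a, b) * v b) = 0))"
proof
  assume "eigenvalue (map_mat complex_of_real A) lam"
  then obtain v where v: "v \<in> carrier_vec n" "v \<noteq> 0\<^sub>v n" "map_mat complex_of_real A *\<^sub>v v = lam \<cdot>\<^sub>v v"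
    using A by (auto simp: eigenvalue_def eigenvector_def)
  have "\<exists>b<n. v $ b \<noteq> 0"
    using v(1,2) by (metis carrier_vecD eq_vecI index_zero_vec(1) index_zero_vec(2))
  moreover have "(\<Sum>b<n. shift_mat A lam $$ (a, b) * v $ b) = 0" if "a < n" for a
    using arg_cong[OF v(3), of "\<lambda>v. v $ a"] A v(1) that
    by (simp add: shift_mat_right_kernel scalar_prod_def atLeast0LessThan)
  ultimately show "\<exists>v. (\<exists>b<n. v b \<noteq> 0) \<and> (\<forall>a<n. (\<Sum>b<n. shift_mat A lam $$ (a, b) * v b) = 0)"
    by blast
next
  assume "\<exists>v. (\<exists>b<n. v b \<noteq> 0) \<and> (\<forall>a<n. (\<Sum>b<n. shift_mat A lam $$ (a, b) * v b) = 0)"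
  then obtain v b where v: "b < n" "v b \<noteq> 0"
    "\<And>a. a < n \<Longrightarrow> (\<Sum>b<n. shift_mat A lam $$ (a, b) * v b) = 0" by blast
  have "vec n v \<noteq> 0\<^sub>v n" using v(1,2) by (metis index_vec index_zero_vec(1))
  moreover have "map_mat complex_of_real A *\<^sub>v vec n v = lam \<cdot>\<^sub>v vec n v"
    using A v(3) by (intro eq_vecI)
      (auto simp: shift_mat_right_kernel scalar_prod_def atLeast0LessThan)
  ultimately show "eigenvalue (map_mat complex_of_real A) lam"
    using A unfolding eigenvalue_def eigenvector_def by (intro exI[of _ "vec n v"]) auto
qed

text \<open>Kalman matrices are real while eigenvectors are complex; this splits a complex kernel
  vector into two real ones.\<close>

lemma sum_complex_eq_0:
  fixes g :: "'a \<Rightarrow> real"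
  assumes "(\<Sum>a\<in>S. u a * complex_of_real (g a)) = 0"
  shows "(\<Sum>a\<in>S. Re (u a) * g a) = 0" "(\<Sum>a\<in>S. Im (u a) * g a) = 0"
  using arg_cong[OF assms, of Re] arg_cong[OF assms, of Im] by simp_all

text \<open>Hautus test: \<open>u A = lam u\<close> and \<open>u H = 0\<close> give
  \<open>u A^k H = lam^k u H = 0\<close>, so \<open>u\<close> annihilates the Kalman matrix, whose
  full row rank forces \<open>u = 0\<close>.\<close>

lemma controllable_left_kernel:
  assumes A: "A \<in> carrier_mat n n" and H: "H \<in> carrier_mat n c" and "controllable A H"
    and uA: "\<And>b. b < n \<Longrightarrow> (\<Sum>a<n. u a * shift_mat A lam $$ (a, b)) = 0"
    and uH: "\<And>l. l < c \<Longrightarrow> (\<Sum>a<n. u a * of_real (H $$ (a, l))) = 0"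
    and "e < n"
  shows "u e = 0"
proof -
  define K where "K = mat_of_cols n (concat (map (\<lambda>k. cols (A ^\<^sub>m k * H)) [0..<n]))"
  have dK: "dim_row K = n" by (simp add: K_def)
  have "rank_ge n (mform K)"
    using assms(3) A by (intro rank_ge_mrank) (simp add: controllable_def K_def Let_def)
  then have rK: "rank_ge (dim_row K) (mform K)" by (simp add: dK)
  have Ak: "A ^\<^sub>m k \<in> carrier_mat n n" for k using A by simp
  have pow: "(\<Sum>a<n. u a * of_real ((A ^\<^sub>m k) $$ (a, b))) = lam ^ k * u b" if "b < n" for k b
    using that
  proof (induction k arbitrary: b)
    case 0
    have "(\<Sum>a<n. u a * of_real ((A ^\<^sub>m 0) $$ (a, b))) = (\<Sum>a<n. u a * (if a = b then 1 else 0))"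
      using A 0 by (intro sum.cong) auto
    then show ?case using 0 by (simp add: sum_mult_delta)
  next
    case (Suc k)
    have "(\<Sum>a<n. u a * of_real ((A ^\<^sub>m Suc k) $$ (a, b)))
        = (\<Sum>a<n. \<Sum>d<n. u a * of_real ((A ^\<^sub>m k) $$ (a, d)) * of_real (A $$ (d, b)))"
      using A Ak[of k] Suc.prems
      by (intro sum.cong) (auto simp: scalar_prod_def atLeast0LessThan sum_distrib_left mult.assoc)
    also have "\<dots> = (\<Sum>d<n. (\<Sum>a<n. u a * of_real ((A ^\<^sub>m k) $$ (a, d))) * of_real (A $$ (d, b)))"
      by (subst sum.swap) (simp add: sum_distrib_right)
    also have "\<dots> = (\<Sum>d<n. lam ^ k * (u d * of_real (A $$ (d, b))))"
      by (simp add: Suc.IH mult.assoc)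
    also have "\<dots> = lam ^ k * (lam * u b)"
      using uA[OF Suc.prems] shift_mat_left_kernel[OF A Suc.prems] by (simp add: sum_distrib_left[symmetric])
    finally show ?case by simp
  qed
  have "(\<Sum>a<n. u a * of_real (K $$ (a, b))) = 0" if b: "b < dim_col K" for b
  proof -
    have dims: "set (cols (A ^\<^sub>m k * H)) \<subseteq> carrier_vec n" for k
      using cols_dim[of "A ^\<^sub>m k * H"] A by simp
    have "set (concat (map (\<lambda>k. cols (A ^\<^sub>m k * H)) [0..<n])) \<subseteq> carrier_vec n"
      using dims by (simp add: UN_subset_iff)
    \<comment> \<open>Every column of the Kalman matrix is a column of some
      \<open>A^k H\<close>.\<close>
    then have "col K b \<in> set (concat (map (\<lambda>k. cols (A ^\<^sub>m k * H)) [0..<n]))"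
      using b mem_cols_iff[of "col K b" K] by (auto simp: K_def cols_mat_of_cols)
    then obtain k l where kl: "l < c" "col K b = col (A ^\<^sub>m k * H) l"
      using H by (auto simp: mem_cols_iff)
    have "(\<Sum>a<n. u a * of_real (K $$ (a, b)))
        = (\<Sum>a<n. \<Sum>d<n. u a * of_real ((A ^\<^sub>m k) $$ (a, d)) * of_real (H $$ (d, l)))"
    proof (intro sum.cong refl)
      fix a assume "a \<in> {..<n}"
      then have a: "a < n" by simp
      have "K $$ (a, b) = (A ^\<^sub>m k * H) $$ (a, l)"
        using arg_cong[OF kl(2), of "\<lambda>v. v $ a"] a b dK A H kl(1) by simp
      then show "u a * of_real (K $$ (a, b))
          = (\<Sum>d<n. u a * of_real ((A ^\<^sub>m k) $$ (a, d)) * of_real (H $$ (d, l)))"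
        using mult_mat_entry[OF Ak H a kl(1)] by (simp add: sum_distrib_left mult.assoc)
    qed
    also have "\<dots> = (\<Sum>d<n. (\<Sum>a<n. u a * of_real ((A ^\<^sub>m k) $$ (a, d))) * of_real (H $$ (d, l)))"
      by (subst sum.swap) (simp add: sum_distrib_right)
    also have "\<dots> = (\<Sum>d<n. lam ^ k * (u d * of_real (H $$ (d, l))))"
      by (simp add: pow mult.assoc)
    also have "\<dots> = 0" using uH[OF kl(1)] by (simp add: sum_distrib_left[symmetric])
    finally show ?thesis .
  qed
  note z = sum_complex_eq_0[OF this]
  have "Re (u e) = 0" "Im (u e) = 0"
    using left_kernel_trivial[OF rK, of "\<lambda>a. Re (u a)" e] left_kernel_trivial[OF rK, of "\<lambda>a. Im (u a)" e]
      z \<open>e < n\<close> dK by auto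
  then show ?thesis by (simp add: complex_eq_iff)
qed

text \<open>The dual Hautus test, with \<open>H A^k v = lam^k H v\<close>.\<close>

lemma observable_right_kernel:
  assumes A: "A \<in> carrier_mat n n" and H: "H \<in> carrier_mat c n" and "observable H A"
    and Av: "\<And>a. a < n \<Longrightarrow> (\<Sum>b<n. shift_mat A lam $$ (a, b) * v b) = 0"
    and Hv: "\<And>l. l < c \<Longrightarrow> (\<Sum>b<n. of_real (H $$ (l, b)) * v b) = 0"
    and "e < n"
  shows "v e = 0"
proof -
  define K where "K = mat_of_rows n (concat (map (\<lambda>k. rows (H * A ^\<^sub>m k)) [0..<n]))"
  have dK: "dim_col K = n" by (simp add: K_def)
  have "rank_ge n (mform K)"
    using assms(3) A by (intro rank_ge_mrank) (simp add: observable_def K_def Let_def)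
  then have rK: "rank_ge (dim_col K) (mform K)" by (simp add: dK)
  have Ak: "A ^\<^sub>m k \<in> carrier_mat n n" for k using A by simp
  have step: "(\<Sum>b<n. of_real (A $$ (a, b)) * v b) = lam * v a" if "a < n" for a
    using Av[OF that] shift_mat_right_kernel[OF A that] by simp
  have pow: "(\<Sum>b<n. of_real ((A ^\<^sub>m k) $$ (a, b)) * v b) = lam ^ k * v a" if "a < n" for k a
    using that
  proof (induction k arbitrary: a)
    case 0
    have "(\<Sum>b<n. of_real ((A ^\<^sub>m 0) $$ (a, b)) * v b) = (\<Sum>b<n. (if a = b then 1 else 0) * v b)"
      using A 0 by (intro sum.cong) auto
    then show ?case using 0 by (simp add: sum_mult_delta)
  next
    case (Suc k)
    have "(\<Sum>b<n. of_real ((A ^\<^sub>m Suc k) $$ (a, b)) * v b)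
        = (\<Sum>b<n. \<Sum>d<n. of_real ((A ^\<^sub>m k) $$ (a, d)) * (of_real (A $$ (d, b)) * v b))"
      using A Ak[of k] Suc.prems
      by (intro sum.cong) (auto simp: scalar_prod_def atLeast0LessThan sum_distrib_right mult.assoc)
    also have "\<dots> = (\<Sum>d<n. of_real ((A ^\<^sub>m k) $$ (a, d)) * (\<Sum>b<n. of_real (A $$ (d, b)) * v b))"
      by (subst sum.swap) (simp add: sum_distrib_left)
    also have "\<dots> = (\<Sum>d<n. lam * (of_real ((A ^\<^sub>m k) $$ (a, d)) * v d))"
      by (simp add: step mult.left_commute)
    also have "\<dots> = lam * (lam ^ k * v a)"
      using Suc by (simp add: sum_distrib_left[symmetric])
    finally show ?case by simp
  qed
  have K0: "(\<Sum>b<n. v b * of_real (K $$ (a, b))) = 0" if a: "a < dim_row K" for a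
  proof -
    have dims: "set (rows (H * A ^\<^sub>m k)) \<subseteq> carrier_vec n" for k
      by (metis Ak rows_carrier carrier_matD(2) index_mult_mat(3))
    have "set (concat (map (\<lambda>k. rows (H * A ^\<^sub>m k)) [0..<n])) \<subseteq> carrier_vec n"
      using dims by (simp add: UN_subset_iff)
    then have "row K a \<in> set (concat (map (\<lambda>k. rows (H * A ^\<^sub>m k)) [0..<n]))"
      using a mem_rows_iff[of "row K a" K] by (auto simp: K_def rows_mat_of_rows)
    then obtain k l where kl: "l < c" "row K a = row (H * A ^\<^sub>m k) l"
      using H by (auto simp: mem_rows_iff)
    have "(\<Sum>b<n. v b * of_real (K $$ (a, b)))
        = (\<Sum>b<n. \<Sum>d<n. of_real (H $$ (l, d)) * (of_real ((A ^\<^sub>m k) $$ (d, b)) * v b))"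
    proof (intro sum.cong refl)
      fix b assume "b \<in> {..<n}"
      then have b: "b < n" by simp
      have "K $$ (a, b) = (H * A ^\<^sub>m k) $$ (l, b)"
        using arg_cong[OF kl(2), of "\<lambda>v. v $ b"] a b dK A H kl(1) by simp
      then show "v b * of_real (K $$ (a, b))
          = (\<Sum>d<n. of_real (H $$ (l, d)) * (of_real ((A ^\<^sub>m k) $$ (d, b)) * v b))"
        using mult_mat_entry[OF H Ak kl(1) b] by (simp add: sum_distrib_left ac_simps)
    qed
    also have "\<dots> = (\<Sum>d<n. of_real (H $$ (l, d)) * (\<Sum>b<n. of_real ((A ^\<^sub>m k) $$ (d, b)) * v b))"
      by (subst sum.swap) (simp add: sum_distrib_left)
    also have "\<dots> = (\<Sum>d<n. lam ^ k * (of_real (H $$ (l, d)) * v d))"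
      by (simp add: pow mult.left_commute)
    also have "\<dots> = 0" using Hv[OF kl(1)] by (simp add: sum_distrib_left[symmetric])
    finally show ?thesis .
  qed
  note z = sum_complex_eq_0[OF K0]
  have "Re (v e) = 0" "Im (v e) = 0"
    using right_kernel_trivial[OF rK, of "\<lambda>a. Re (v a)" e] right_kernel_trivial[OF rK, of "\<lambda>a. Im (v a)" e]
      z \<open>e < n\<close> dK by (auto simp: mult.commute)
  then show ?thesis by (simp add: complex_eq_iff)
qed

text \<open>A column of channel \<open>fst k\<close> acting on row vectors \<open>u\<close>. Indices
  are pairs of a channel and a position inside its matrix, so borders of several channels need no
  offsets.\<close>

definition colfun :: "(nat \<Rightarrow> real mat) \<Rightarrow> nat \<times> nat \<Rightarrow> (nat \<Rightarrow> complex) \<Rightarrow> complex" where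
  "colfun M k u = (\<Sum>a<dim_row (M (fst k)). u a * of_real (M (fst k) $$ (a, snd k)))"

definition rowfun :: "(nat \<Rightarrow> real mat) \<Rightarrow> nat \<times> nat \<Rightarrow> (nat \<Rightarrow> complex) \<Rightarrow> complex" where
  "rowfun M k v = (\<Sum>b<dim_col (M (fst k)). of_real (M (fst k) $$ (snd k, b)) * v b)"

definition cols_of :: "(nat \<Rightarrow> real mat) \<Rightarrow> nat set \<Rightarrow> (nat \<times> nat) set" where
  "cols_of M S = (SIGMA i:S. {..<dim_col (M i)})"

definition rows_of :: "(nat \<Rightarrow> real mat) \<Rightarrow> nat set \<Rightarrow> (nat \<times> nat) set" where
  "rows_of M S = (SIGMA i:S. {..<dim_row (M i)})"

lemma linear_colfun: "linear_functional fun_scale (colfun M k)"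
  by (simp add: linear_functional_def colfun_def fun_scale_def algebra_simps sum.distrib sum_distrib_left)

lemma linear_rowfun: "linear_functional fun_scale (rowfun M k)"
  by (simp add: linear_functional_def rowfun_def fun_scale_def algebra_simps sum.distrib sum_distrib_left)

text \<open>\<open>rank [lam I - A, B\<^sub>S; C\<^sub>T, 0] \<ge> r\<close>, with the border contributing arbitrary elements of the
  spans of the columns and rows, so that no order of the columns and rows has to be fixed.\<close>
definition pbh_witness :: "real mat \<Rightarrow> (nat \<Rightarrow> real mat) \<Rightarrow> (nat \<Rightarrow> real mat) \<Rightarrow> nat set \<Rightarrow> nat set
    \<Rightarrow> complex \<Rightarrow> nat \<Rightarrow> bool" where
  "pbh_witness A B C S T lam r \<longleftrightarrow> (\<exists>p q \<beta> \<gamma>.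
     (\<forall>j<r. \<beta> j \<in> lspan (cols_of B S) (colfun B)) \<and> (\<forall>i<r. \<gamma> i \<in> lspan (rows_of C T) (rowfun C)) \<and>
     (\<forall>i<r. \<forall>j<r. mform (shift_mat A lam) (p i) (q j) + \<beta> j (p i) + \<gamma> i (q j) = (if i = j then 1 else 0)))"

lemma mform_pbh:
  fixes B C :: "nat \<Rightarrow> real mat"
  assumes A: "A \<in> carrier_mat n n"
    and HB: "HB = hcat n B S" and HC: "HC = vcat n C ({0..<m} - S)"
  shows "mform (pbh_mat A B C m S lam) u v = mform (shift_mat A lam) u v
    + (\<Sum>l<dim_col HB. v (n + l) * (\<Sum>a<n. u a * of_real (HB $$ (a, l))))
    + (\<Sum>l<dim_row HC. u (n + l) * (\<Sum>b<n. of_real (HC $$ (l, b)) * v b))"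
proof -
  define W where "W = pbh_mat A B C m S lam"
  have W: "W = four_block_mat (shift_mat A lam) (map_mat complex_of_real HB) (map_mat complex_of_real HC)
      (0\<^sub>m (dim_row HC) (dim_col HB))"
    using A by (simp add: W_def pbh_mat_def HB HC Let_def shift_mat_def)
  have dims: "dim_row HB = n" "dim_col HC = n" "dim_row A = n" "dim_col A = n"
    using A by (simp_all add: HB HC dim_hcat dim_vcat)
  have dW: "dim_row W = n + dim_row HC" "dim_col W = n + dim_col HB"
    by (simp_all add: W shift_mat_dim dims)
  have e: "W $$ (a, b) = shift_mat A lam $$ (a, b)" if "a < n" "b < n" for a b
    using that by (simp add: W shift_mat_dim dims)
  have e2: "W $$ (a, n + l) = of_real (HB $$ (a, l))" if "a < n" "l < dim_col HB" for a l
    using that by (simp add: W shift_mat_dim dims)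
  have e3: "W $$ (n + l, b) = of_real (HC $$ (l, b))" if "b < n" "l < dim_row HC" for b l
    using that by (simp add: W shift_mat_dim dims)
  have e4: "W $$ (n + l, n + l') = 0" if "l < dim_row HC" "l' < dim_col HB" for l l'
    using that by (simp add: W shift_mat_dim dims)
  have "mform W u v = (\<Sum>a<n. (\<Sum>b<n. u a * W $$ (a, b) * v b)
        + (\<Sum>l<dim_col HB. u a * W $$ (a, n + l) * v (n + l)))
      + (\<Sum>l<dim_row HC. (\<Sum>b<n. u (n + l) * W $$ (n + l, b) * v b)
        + (\<Sum>l'<dim_col HB. u (n + l) * W $$ (n + l, n + l') * v (n + l')))"
    by (simp add: mform_def dW sum_lessThan_add)
  also have "\<dots> = (\<Sum>a<n. \<Sum>b<n. u a * shift_mat A lam $$ (a, b) * v b)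
      + (\<Sum>a<n. \<Sum>l<dim_col HB. v (n + l) * (u a * of_real (HB $$ (a, l))))
      + (\<Sum>l<dim_row HC. u (n + l) * (\<Sum>b<n. of_real (HC $$ (l, b)) * v b))"
    by (simp add: sum.distrib e e2 e3 e4 sum_distrib_left mult.assoc mult.commute mult.left_commute)
  also have "(\<Sum>a<n. \<Sum>l<dim_col HB. v (n + l) * (u a * of_real (HB $$ (a, l))))
      = (\<Sum>l<dim_col HB. v (n + l) * (\<Sum>a<n. u a * of_real (HB $$ (a, l))))"
    by (subst sum.swap) (simp add: sum_distrib_left)
  finally show ?thesis by (simp add: W_def mform_def shift_mat_dim dims)
qed

text \<open>The coordinates of the compressing vectors beyond \<open>n\<close> weight the border
  columns and rows of the concatenations. Each of these is a column of some \<open>B i\<close> or a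
  row of some \<open>C i\<close>, so the weighted sums lie in the required spans.\<close>

lemma pbh_witnessI:
  assumes A: "A \<in> carrier_mat n n"
    and B: "\<And>i. i < m \<Longrightarrow> dim_row (B i) = n" and C: "\<And>i. i < m \<Longrightarrow> dim_col (C i) = n"
    and S: "S \<subseteq> {0..<m}" and r: "rank_ge r (mform (pbh_mat A B C m S lam))"
  shows "pbh_witness A B C S ({0..<m} - S) lam r"
proof -
  define HB HC where "HB = hcat n B S" and "HC = vcat n C ({0..<m} - S)"
  obtain p q where pq: "\<And>i j. i < r \<Longrightarrow> j < r \<Longrightarrow>
      mform (pbh_mat A B C m S lam) (p i) (q j) = (if i = j then 1 else 0)"
    using r unfolding rank_ge_def by blast
  define \<beta> where "\<beta> j u = (\<Sum>l<dim_col HB. q j (n + l) * (\<Sum>a<n. u a * of_real (HB $$ (a, l))))"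
    for j :: nat and u :: "nat \<Rightarrow> complex"
  define \<gamma> where "\<gamma> i v = (\<Sum>l<dim_row HC. p i (n + l) * (\<Sum>b<n. of_real (HC $$ (l, b)) * v b))"
    for i :: nat and v :: "nat \<Rightarrow> complex"
  have fin: "finite S" using S finite_subset by blast
  have col: "(\<lambda>u. \<Sum>a<n. u a * complex_of_real (HB $$ (a, l))) \<in> lspan (cols_of B S) (colfun B)"
    if l: "l < dim_col HB" for l
  proof -
    obtain i c where ic: "i \<in> S" "c < dim_col (B i)" "\<And>a. a < n \<Longrightarrow> HB $$ (a, l) = B i $$ (a, c)"
      using hcat_entry[of S B n l] fin B S l unfolding HB_def by (metis atLeastLessThan_iff subsetD)
    have "colfun B (i, c) \<in> lspan (cols_of B S) (colfun B)"
      using ic fin by (intro lspan_base) (auto simp: cols_of_def)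
    moreover have "dim_row (B i) = n" using B ic(1) S by auto
    ultimately show ?thesis using ic(3) by (simp add: colfun_def[abs_def])
  qed
  have row: "(\<lambda>v. \<Sum>b<n. complex_of_real (HC $$ (l, b)) * v b) \<in> lspan (rows_of C ({0..<m} - S)) (rowfun C)"
    if l: "l < dim_row HC" for l
  proof -
    obtain i c where ic: "i \<in> {0..<m} - S" "c < dim_row (C i)" "\<And>b. b < n \<Longrightarrow> HC $$ (l, b) = C i $$ (c, b)"
      using vcat_entry[of "{0..<m} - S" C n l] C l unfolding HC_def
      by (metis DiffD1 atLeastLessThan_iff finite_Diff finite_atLeastLessThan)
    have "rowfun C (i, c) \<in> lspan (rows_of C ({0..<m} - S)) (rowfun C)"
      using ic by (intro lspan_base) (auto simp: rows_of_def)
    moreover have "dim_col (C i) = n" using C ic(1) by auto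
    ultimately show ?thesis using ic(3) by (simp add: rowfun_def[abs_def])
  qed
  have "\<beta> j \<in> lspan (cols_of B S) (colfun B)" for j
    unfolding \<beta>_def[abs_def] by (rule lspan_sum, rule lspan_scale, rule col) simp
  moreover have "\<gamma> i \<in> lspan (rows_of C ({0..<m} - S)) (rowfun C)" for i
    unfolding \<gamma>_def[abs_def] by (rule lspan_sum, rule lspan_scale, rule row) simp
  moreover have "mform (shift_mat A lam) (p i) (q j) + \<beta> j (p i) + \<gamma> i (q j) = (if i = j then 1 else 0)"
    if "i < r" "j < r" for i j
    using pq[OF that] mform_pbh[OF A HB_def HC_def, of lam "p i" "q j"] by (simp add: \<beta>_def \<gamma>_def)
  ultimately show ?thesis unfolding pbh_witness_def by blast
qed

text \<open>With all inputs in the border the matrix is \<open>[lam I - A, B]\<close>, and by the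
  Hautus test its left kernel is trivial.\<close>

lemma pbh_witness_controllable:
  assumes A: "A \<in> carrier_mat n n"
    and B: "\<And>i. i < m \<Longrightarrow> dim_row (B i) = n" and C: "\<And>i. i < m \<Longrightarrow> dim_col (C i) = n"
    and ctrb: "controllable A (hcat n B {0..<m})"
  shows "pbh_witness A B C {0..<m} {} lam n"
proof -
  define W where "W = pbh_mat A B C m {0..<m} lam"
  define HB where "HB = hcat n B {0..<m}"
  have dims: "dim_row HB = n" "dim_row A = n" "dim_col A = n"
    using A by (simp_all add: HB_def dim_hcat)
  have H: "HB \<in> carrier_mat n (dim_col HB)" using dims by auto
  \<comment> \<open>Concatenating over no channels leaves an output border with zero rows.\<close>
  have W: "W = four_block_mat (shift_mat A lam) (map_mat complex_of_real HB) (0\<^sub>m 0 n) (0\<^sub>m 0 (dim_col HB))"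
    using A by (auto simp: W_def pbh_mat_def HB_def Let_def shift_mat_def vcat_def intro!: arg_cong2[of _ _ _ _ "\<lambda>x y. four_block_mat _ _ x y"])
  have dW: "dim_row W = n" "dim_col W = n + dim_col HB" by (simp_all add: W shift_mat_dim dims)
  have "rank_ge (dim_row W) (mform W)"
  proof (rule ccontr)
    assume "\<not> ?thesis"
    then obtain u e where u: "e < n" "u e \<noteq> 0"
      "\<And>b. b < n + dim_col HB \<Longrightarrow> (\<Sum>a<n. u a * W $$ (a, b)) = 0"
      using left_kernel_exists[of W] dW by auto
    have "(\<Sum>a<n. u a * shift_mat A lam $$ (a, b)) = 0" if "b < n" for b
      using u(3)[of b] that by (simp add: W shift_mat_dim dims)
    moreover have "(\<Sum>a<n. u a * of_real (HB $$ (a, l))) = 0" if "l < dim_col HB" for l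
      using u(3)[of "n + l"] that by (simp add: W shift_mat_dim dims)
    ultimately show False
      using controllable_left_kernel[OF A H] ctrb u(1,2) HB_def by blast
  qed
  then show ?thesis using pbh_witnessI[where m = m and S = "{0..<m}" and r = n and lam = lam, OF A B C] dW(1) by (simp add: W_def)
qed

lemma pbh_witness_observable:
  assumes A: "A \<in> carrier_mat n n"
    and B: "\<And>i. i < m \<Longrightarrow> dim_row (B i) = n" and C: "\<And>i. i < m \<Longrightarrow> dim_col (C i) = n"
    and obsv: "observable (vcat n C {0..<m}) A"
  shows "pbh_witness A B C {} {0..<m} lam n"
proof -
  define W where "W = pbh_mat A B C m {} lam"
  define HC where "HC = vcat n C {0..<m}"
  have dims: "dim_col HC = n" "dim_row A = n" "dim_col A = n"
    using A by (simp_all add: HC_def dim_vcat)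
  have H: "HC \<in> carrier_mat (dim_row HC) n" using dims by auto
  have W: "W = four_block_mat (shift_mat A lam) (0\<^sub>m n 0) (map_mat complex_of_real HC) (0\<^sub>m (dim_row HC) 0)"
    using A by (auto simp: W_def pbh_mat_def HC_def Let_def shift_mat_def hcat_def intro!: arg_cong2[of _ _ _ _ "\<lambda>x y. four_block_mat _ x _ y"])
  have dW: "dim_col W = n" "dim_row W = n + dim_row HC" by (simp_all add: W shift_mat_dim dims)
  have "rank_ge (dim_col W) (mform W)"
  proof (rule ccontr)
    assume "\<not> ?thesis"
    then obtain v e where v: "e < n" "v e \<noteq> 0"
      "\<And>a. a < n + dim_row HC \<Longrightarrow> (\<Sum>b<n. W $$ (a, b) * v b) = 0"
      using right_kernel_exists[of W] dW by auto
    have "(\<Sum>b<n. shift_mat A lam $$ (a, b) * v b) = 0" if "a < n" for a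
      using v(3)[of a] that by (simp add: W shift_mat_dim dims)
    moreover have "(\<Sum>b<n. of_real (HC $$ (l, b)) * v b) = 0" if "l < dim_row HC" for l
      using v(3)[of "n + l"] that by (simp add: W shift_mat_dim dims)
    ultimately show False
      using observable_right_kernel[OF A H] obsv v(1,2) HC_def by blast
  qed
  then show ?thesis using pbh_witnessI[where m = m and S = "{}" and r = n and lam = lam, OF A B C] dW(1) by (simp add: W_def)
qed

text \<open>Off the spectrum \<open>lam I - A\<close> is invertible, so the border may contribute
  zero.\<close>

lemma pbh_witness_noneigenvalue:
  assumes A: "A \<in> carrier_mat n n" and "\<not> eigenvalue (map_mat complex_of_real A) lam"
  shows "pbh_witness A B C S T lam n"
proof -
  have d: "dim_row (shift_mat A lam) = n" "dim_col (shift_mat A lam) = n" using A by (auto simp: shift_mat_dim)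
  have "rank_ge n (mform (shift_mat A lam))"
  proof (rule ccontr)
    assume "\<not> ?thesis"
    then have "\<not> rank_ge (dim_col (shift_mat A lam)) (mform (shift_mat A lam))" by (simp add: d)
    from right_kernel_exists[OF this] show False
      using assms(2) unfolding eigenvalue_iff_shift_kernel[OF A] d by blast
  qed
  then obtain p q where "\<And>i j. i < n \<Longrightarrow> j < n \<Longrightarrow> mform (shift_mat A lam) (p i) (q j) = (if i = j then 1 else 0)"
    unfolding rank_ge_def by blast
  then show ?thesis unfolding pbh_witness_def
    by (intro exI[of _ p] exI[of _ q] exI[of _ "\<lambda>_ _. 0"]) (simp add: lspan_zero)
qed

subsection \<open>The extended system\<close>

lemma zoff_mono: "i < j \<Longrightarrow> zoff nn i + nn i \<le> zoff nn j"
proof -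
  assume "i < j"
  then have "sum nn {..<Suc i} \<le> sum nn {..<j}" by (intro sum_mono2) auto
  then show ?thesis by (simp add: zoff_def)
qed

lemma zoff_less: "k < m \<Longrightarrow> c < nn k \<Longrightarrow> zoff nn k + c < (\<Sum>k<m. nn k)"
  using zoff_mono[of k m nn] by (simp add: zoff_def)

text \<open>The blocks of the stacked controller state occupy disjoint intervals.\<close>

lemma zoff_inj:
  assumes "c < nn k" "c' < nn k'"
  shows "zoff nn k + c = zoff nn k' + c' \<longleftrightarrow> k = k' \<and> c = c'"
  using assms zoff_mono[of k k' nn] zoff_mono[of k' k nn] by (cases k k' rule: linorder_cases) auto

definition unit_fun :: "nat \<Rightarrow> nat \<Rightarrow> complex" where
  "unit_fun a = (\<lambda>i. if i = a then 1 else 0)"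

definition trunc_fun :: "nat \<Rightarrow> (nat \<Rightarrow> complex) \<Rightarrow> nat \<Rightarrow> complex" where
  "trunc_fun n u = (\<lambda>i. if i < n then u i else 0)"

lemma mform_shift_Abar:
  assumes A: "A \<in> carrier_mat n n"
  shows "mform (shift_mat (Abar A m nn) lam) u v
    = mform (shift_mat A lam) u v + lam * (\<Sum>z<(\<Sum>k<m. nn k). u (n + z) * v (n + z))"
proof -
  define N where "N = (\<Sum>k<m. nn k)"
  define W where "W = shift_mat (Abar A m nn) lam"
  have Ab: "Abar A m nn = four_block_mat A (0\<^sub>m n N) (0\<^sub>m N n) (0\<^sub>m N N)"
    using A by (simp add: Abar_def N_def Let_def)
  have dA: "dim_row A = n" "dim_col A = n" using A by auto
  have d: "dim_row (Abar A m nn) = n + N" "dim_col (Abar A m nn) = n + N" by (simp_all add: Ab dA)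
  have e: "W $$ (a, b) = shift_mat A lam $$ (a, b)" if "a < n" "b < n" for a b
    using that by (simp add: W_def shift_mat_entry d dA) (simp add: Ab dA)
  have e2: "W $$ (a, n + z) = 0" if "a < n" "z < N" for a z
    using that by (simp add: W_def shift_mat_entry d dA) (simp add: Ab dA)
  have e3: "W $$ (n + z, b) = 0" if "b < n" "z < N" for b z
    using that by (simp add: W_def shift_mat_entry d dA) (simp add: Ab dA)
  have e4: "W $$ (n + z, n + z') = lam * (if z = z' then 1 else 0)" if "z < N" "z' < N" for z z'
    using that by (simp add: W_def shift_mat_entry d dA) (simp add: Ab dA)
  have "mform W u v = (\<Sum>a<n. (\<Sum>b<n. u a * W $$ (a, b) * v b)
        + (\<Sum>z<N. u a * W $$ (a, n + z) * v (n + z)))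
      + (\<Sum>z<N. (\<Sum>b<n. u (n + z) * W $$ (n + z, b) * v b)
        + (\<Sum>z'<N. u (n + z) * W $$ (n + z, n + z') * v (n + z')))"
    by (simp add: mform_def W_def shift_mat_dim d sum_lessThan_add)
  also have "\<dots> = (\<Sum>a<n. \<Sum>b<n. u a * shift_mat A lam $$ (a, b) * v b)
      + (\<Sum>z<N. (\<Sum>z'<N. u (n + z) * W $$ (n + z, n + z') * v (n + z')))"
    by (simp add: e e2 e3)
  also have "(\<Sum>z<N. (\<Sum>z'<N. u (n + z) * W $$ (n + z, n + z') * v (n + z')))
      = (\<Sum>z<N. lam * u (n + z) * (\<Sum>z'<N. (if z = z' then 1 else 0) * v (n + z')))"
    by (intro sum.cong refl) (simp add: e4 sum_distrib_left mult.assoc mult.commute mult.left_commute)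
  also have "\<dots> = lam * (\<Sum>z<N. u (n + z) * v (n + z))"
    by (simp add: sum_mult_delta sum_distrib_left mult.assoc)
  finally show ?thesis by (simp add: W_def N_def mform_def shift_mat_dim dA)
qed

lemma dim_Emat: "dim_row (Emat m nn i) = (\<Sum>k<m. nn k)" "dim_col (Emat m nn i) = nn i"
  by (simp_all add: Emat_def)

lemma sum_unit_mult:
  fixes f :: "nat \<Rightarrow> 'a::semiring_1"
  assumes "z < N"
  shows "(\<Sum>a<n + N. f a * (if n \<le> a then (if a - n = z then 1 else 0) else 0)) = f (n + z)"
proof -
  have "(\<Sum>a<n + N. f a * (if n \<le> a then (if a - n = z then 1 else 0) else 0))
      = (\<Sum>a<n + N. f a * (if a = n + z then 1 else 0))"
    by (intro sum.cong refl) auto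
  then show ?thesis using assms by (simp add: sum_mult_delta)
qed

lemma Bbar_dims:
  assumes "dim_row A = n" "dim_row (B i) = n"
  shows "dim_row (Bbar A B m nn i) = n + (\<Sum>k<m. nn k)"
    "dim_col (Bbar A B m nn i) = dim_col (B i) + nn i"
  using assms by (simp_all add: Bbar_def Let_def dim_Emat)

lemma colfun_Bbar_state:
  assumes "dim_row A = n" "dim_row (B i) = n" "c < dim_col (B i)"
  shows "colfun (Bbar A B m nn) (i, c) = colfun B (i, c)"
proof
  fix u
  have "Bbar A B m nn i $$ (a, c) = (if a < n then B i $$ (a, c) else 0)" if "a < n + (\<Sum>k<m. nn k)" for a
    using that assms by (simp add: Bbar_def Let_def dim_Emat)
  then show "colfun (Bbar A B m nn) (i, c) u = colfun B (i, c) u"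
    using assms by (simp add: colfun_def Bbar_dims sum_lessThan_add)
qed

lemma colfun_Bbar_ctrl:
  assumes "dim_row A = n" "dim_row (B i) = n" "i < m" "c < nn i"
  shows "colfun (Bbar A B m nn) (i, dim_col (B i) + c) = (\<lambda>u. u (n + (zoff nn i + c)))"
proof
  fix u
  have z: "zoff nn i + c < (\<Sum>k<m. nn k)" using assms by (intro zoff_less) auto
  have "complex_of_real (Bbar A B m nn i $$ (a, dim_col (B i) + c))
      = (if n \<le> a then (if a - n = zoff nn i + c then 1 else 0) else 0)"
    if "a < n + (\<Sum>k<m. nn k)" for a
    using that assms by (auto simp: Bbar_def Let_def dim_Emat) (auto simp: Emat_def)
  then show "colfun (Bbar A B m nn) (i, dim_col (B i) + c) u = u (n + (zoff nn i + c))"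
    using assms sum_unit_mult[OF z, of u n] by (simp add: colfun_def Bbar_dims)
qed

lemma Cbar_dims:
  assumes "dim_row A = n" "dim_col (C i) = n"
  shows "dim_col (Cbar A C m nn N i) = n + (\<Sum>k<m. nn k)"
    "dim_row (Cbar A C m nn N i) = dim_row (C i) + dim_col (Eset m nn (N i))"
  using assms by (simp_all add: Cbar_def Let_def Eset_def dim_hcat)

lemma rowfun_Cbar_state:
  assumes "dim_row A = n" "dim_col (C i) = n" "c < dim_row (C i)"
  shows "rowfun (Cbar A C m nn N) (i, c) = rowfun C (i, c)"
proof
  fix v
  have "Cbar A C m nn N i $$ (c, b) = (if b < n then C i $$ (c, b) else 0)" if "b < n + (\<Sum>k<m. nn k)" for b
    using that assms by (simp add: Cbar_def Let_def Eset_def dim_hcat)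
  then show "rowfun (Cbar A C m nn N) (i, c) v = rowfun C (i, c) v"
    using assms by (simp add: rowfun_def Cbar_dims sum_lessThan_add)
qed

text \<open>Measuring \<open>z_k\<close> for a neighbor \<open>k\<close> gives access to each of its
  coordinates. The row is only asserted to exist, because its position depends on the sorted order
  of \<open>N i\<close>.\<close>

lemma rowfun_Cbar_ctrl:
  assumes "dim_row A = n" "dim_col (C i) = n" "finite (N i)" "k \<in> N i" "k < m" "c < nn k"
  obtains \<rho> where "\<rho> < dim_row (Cbar A C m nn N i)"
    "rowfun (Cbar A C m nn N) (i, \<rho>) = (\<lambda>v. v (n + (zoff nn k + c)))"
proof -
  have z: "zoff nn k + c < (\<Sum>k<m. nn k)" using assms by (intro zoff_less) auto
  obtain l where l: "l < dim_col (Eset m nn (N i))"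
    "\<And>a. a < (\<Sum>k<m. nn k) \<Longrightarrow> Eset m nn (N i) $$ (a, l) = Emat m nn k $$ (a, c)"
    using hcat_entry_ex[of "N i" "Emat m nn" "\<Sum>k<m. nn k" k c] assms(3,4,6)
    unfolding Eset_def dim_Emat by blast
  have "complex_of_real (Cbar A C m nn N i $$ (dim_row (C i) + l, b))
      = (if n \<le> b then (if b - n = zoff nn k + c then 1 else 0) else 0)"
    if "b < n + (\<Sum>k<m. nn k)" for b
  proof -
    have dE: "dim_row (Eset m nn (N i)) = (\<Sum>k<m. nn k)" by (simp add: Eset_def dim_hcat)
    have "Cbar A C m nn N i $$ (dim_row (C i) + l, b) = (if b < n then 0 else Eset m nn (N i) $$ (b - n, l))"
      using that assms l(1) dE by (auto simp: Cbar_def Let_def)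
    then show ?thesis using that l assms(6) by (auto simp: Emat_def)
  qed
  then have "rowfun (Cbar A C m nn N) (i, dim_row (C i) + l) v = v (n + (zoff nn k + c))" for v
    using assms sum_unit_mult[OF z, of v n] by (simp add: rowfun_def Cbar_dims mult.commute)
  then show ?thesis using l(1) assms by (intro that[of "dim_row (C i) + l"]) (auto simp: Cbar_dims)
qed

text \<open>A channel in \<open>S\<close> controls its own block of controller states, a channel outside \<open>S\<close>
  measures the blocks of its neighbors; a block that is both controlled and measured counts twice,
  because \<open>[lam, 1; 1, 0]\<close> is invertible for every \<open>lam\<close>.\<close>
lemma extended_rank:
  fixes B C :: "nat \<Rightarrow> real mat" and nn :: "nat \<Rightarrow> nat" and N :: "nat \<Rightarrow> nat set"
  assumes Bb_def: "Bb = Bbar A B m nn" and Cb_def: "Cb = Cbar A C m nn N"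
    and A: "A \<in> carrier_mat n n"
    and B: "\<And>i. i < m \<Longrightarrow> dim_row (B i) = n" and C: "\<And>i. i < m \<Longrightarrow> dim_col (C i) = n"
    and N: "\<And>i. i < m \<Longrightarrow> N i \<subseteq> {0..<m}"
    and S: "S \<subseteq> {0..<m}" and T: "T \<subseteq> {0..<m}"
    and fin: "finite X" "finite Y" and X: "cols_of Bb S \<subseteq> X" and Y: "rows_of Cb T \<subseteq> Y"
    and wit: "pbh_witness A B C S T lam r"
  shows "rank_ge (r + (\<Sum>k\<in>S. nn k) + (\<Sum>k\<in>\<Union>(N ` T). nn k))
    (aug X Y (mform (shift_mat (Abar A m nn) lam)) (colfun Bb) (rowfun Cb))"
proof -
  \<comment> \<open>\<open>e z\<close> is the position, in the extended state, of coordinate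
    \<open>snd z\<close> of controller block \<open>fst z\<close>.\<close>
  define e where "e z = n + (zoff nn (fst z) + snd z)" for z
  \<comment> \<open>Coordinates controlled from \<open>S\<close> and coordinates measured from
    \<open>T\<close>; the two sets may overlap.\<close>
  define ZS ZN where "ZS = (SIGMA k:S. {..<nn k})" and "ZN = (SIGMA k:\<Union>(N ` T). {..<nn k})"
  have dA: "dim_row A = n" using A by simp
  have dS: "dim_row (B i) = n" "i < m" if "i \<in> S" for i using B S that by auto
  have dT: "dim_col (C i) = n" "i < m" "finite (N i)" if "i \<in> T" for i
  proof -
    show "dim_col (C i) = n" "i < m" using C T that by auto
    then show "finite (N i)" using N finite_subset by blast
  qed
  have UN: "\<Union>(N ` T) \<subseteq> {0..<m}" using N dT(2) by blast
  have finS: "finite S" "finite (\<Union>(N ` T))" using S UN finite_subset by blast+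
  have Zm: "fst z < m" "snd z < nn (fst z)" if "z \<in> ZS \<union> ZN" for z
    using that S UN by (auto simp: ZS_def ZN_def)
  have e_less: "zoff nn (fst z) + snd z < (\<Sum>k<m. nn k)" if "z \<in> ZS \<union> ZN" for z
    using zoff_less Zm[OF that] by blast
  have e_inj: "e z = e z' \<longleftrightarrow> z = z'" if "z \<in> ZS \<union> ZN" "z' \<in> ZS \<union> ZN" for z z'
    using zoff_inj[of "snd z" nn "fst z" "snd z'" "fst z'"] Zm[OF that(1)] Zm[OF that(2)]
    by (auto simp: e_def prod_eq_iff)
  have e_ge: "\<not> e z < n" for z by (simp add: e_def)
  obtain p0 q0 \<beta>0 \<gamma>0 where \<beta>0: "\<And>j. j < r \<Longrightarrow> \<beta>0 j \<in> lspan (cols_of B S) (colfun B)"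
    and \<gamma>0: "\<And>i. i < r \<Longrightarrow> \<gamma>0 i \<in> lspan (rows_of C T) (rowfun C)"
    and id0: "\<And>i j. i < r \<Longrightarrow> j < r \<Longrightarrow>
      mform (shift_mat A lam) (p0 i) (q0 j) + \<beta>0 j (p0 i) + \<gamma>0 i (q0 j) = (if i = j then 1 else 0)"
    using wit unfolding pbh_witness_def by blast
  have \<beta>_cong: "\<beta>0 j u = \<beta>0 j u'" if "j < r" "\<And>a. a < n \<Longrightarrow> u a = u' a" for j u u'
    using lspan_cong[OF \<beta>0[OF that(1)], of u u'] that(2) dS(1) by (auto simp: colfun_def cols_of_def)
  have \<gamma>_cong: "\<gamma>0 i v = \<gamma>0 i v'" if "i < r" "\<And>b. b < n \<Longrightarrow> v b = v' b" for i v v'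
    using lspan_cong[OF \<gamma>0[OF that(1)], of v v'] that(2) dT(1) by (auto simp: rowfun_def rows_of_def)
  have \<beta>_zero: "\<beta>0 j (\<lambda>_. 0) = 0" if "j < r" for j
    using \<beta>0[OF that] by (auto simp: lspan_def colfun_def)
  have \<gamma>_zero: "\<gamma>0 i (\<lambda>_. 0) = 0" if "i < r" for i
    using \<gamma>0[OF that] by (auto simp: lspan_def rowfun_def)
  define W where "W = mform (shift_mat (Abar A m nn) lam)"
  define w where "w = mform (shift_mat A lam)"
  have Ww: "W u v = w u v + lam * (\<Sum>z<(\<Sum>k<m. nn k). u (n + z) * v (n + z))" for u v
    unfolding W_def w_def by (rule mform_shift_Abar[OF A])
  have w_cong: "w u v = w u' v'" if "\<And>a. a < n \<Longrightarrow> u a = u' a" "\<And>a. a < n \<Longrightarrow> v a = v' a" for u u' v v'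
    using that A by (auto simp: w_def mform_def shift_mat_dim intro!: sum.cong)
  have w_zero: "w (\<lambda>_. 0) v = 0" "w u (\<lambda>_. 0) = 0" for u v by (simp_all add: w_def mform_def)
  \<comment> \<open>Three kinds of indices: those of the given witness, extended by zero; controlled
    coordinates, with a unit vector on the left and the border column on the right; measured
    coordinates, with the border row on the left and a unit vector on the right.\<close>
  define p where "p = case_sum (\<lambda>i. trunc_fun n (p0 i)) (case_sum (\<lambda>z. unit_fun (e z)) (\<lambda>(z :: nat \<times> nat) _. 0))"
  define q where "q = case_sum (\<lambda>j. trunc_fun n (q0 j)) (case_sum (\<lambda>(z :: nat \<times> nat) _. 0) (\<lambda>z. unit_fun (e z)))"
  \<comment> \<open>For a coordinate both controlled and measured, the two unit vectors meet in the
    diagonal entry \<open>lam\<close>; the term \<open>- lam\<close> cancels it through the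
    available border column.\<close>
  define \<beta> where "\<beta> = case_sum \<beta>0 (case_sum (\<lambda>z u. u (e z)) (\<lambda>z u. (if z \<in> ZS then - lam else 0) * u (e z)))"
  define \<gamma> where "\<gamma> = case_sum \<gamma>0 (case_sum (\<lambda>(z :: nat \<times> nat) _. 0) (\<lambda>z v. v (e z)))"
  \<comment> \<open>The disjoint sum keeps both copies of a coordinate in the overlap.\<close>
  define K where "K = {..<r} <+> (ZS <+> ZN)"
  have coord\<beta>: "(\<lambda>u. u (e z)) \<in> lspan X (colfun Bb)" if z: "z \<in> ZS" for z
  proof -
    have S: "fst z \<in> S" "snd z < nn (fst z)" using z by (auto simp: ZS_def)
    have "(fst z, dim_col (B (fst z)) + snd z) \<in> X"
      using S X dS dA by (auto simp: cols_of_def Bb_def Bbar_dims)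
    from lspan_base[OF fin(1) this, of "colfun Bb"] show ?thesis
      using colfun_Bbar_ctrl[of A n B "fst z" m "snd z" nn] dA dS S by (simp add: Bb_def e_def)
  qed
  have coord\<gamma>: "(\<lambda>v. v (e z)) \<in> lspan Y (rowfun Cb)" if z: "z \<in> ZN" for z
  proof -
    obtain i where i: "i \<in> T" "fst z \<in> N i" "snd z < nn (fst z)" using z by (auto simp: ZN_def)
    have "fst z < m" using Zm z by blast
    then obtain \<rho> where \<rho>: "\<rho> < dim_row (Cb i)" "rowfun Cb (i, \<rho>) = (\<lambda>v. v (e z))"
      using rowfun_Cbar_ctrl[of A n C i N "fst z" m "snd z" nn] dA dT[OF i(1)] i by (metis Cb_def e_def)
    have "(i, \<rho>) \<in> Y" using Y i(1) \<rho>(1) by (auto simp: rows_of_def)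
    from lspan_base[OF fin(2) this, of "rowfun Cb"] show ?thesis by (simp add: \<rho>(2))
  qed
  have \<beta>X: "\<beta> j \<in> lspan X (colfun Bb)" if jK: "j \<in> K" for j
  proof -
    consider (1) i where "j = Inl i" "i < r" | (2) z where "j = Inr (Inl z)" "z \<in> ZS"
      | (3) z where "j = Inr (Inr z)" "z \<in> ZN" using jK by (auto simp: K_def)
    then show ?thesis
    proof cases
      case 1
      have "\<beta>0 i \<in> lspan X (colfun Bb)"
      proof (rule lspan_mono[OF fin(1) \<beta>0[OF 1(2)]])
        show "cols_of B S \<subseteq> X" using X dS dA by (force simp: cols_of_def Bb_def Bbar_dims)
        show "colfun B k = colfun Bb k" if "k \<in> cols_of B S" for k
          using that dS dA by (auto simp: cols_of_def Bb_def colfun_Bbar_state)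
      qed
      then show ?thesis by (simp add: 1 \<beta>_def)
    next
      case 2
      then show ?thesis using coord\<beta> by (simp add: \<beta>_def)
    next
      case 3
      show ?thesis
      proof (cases "z \<in> ZS")
        case True
        then show ?thesis using lspan_scale[OF coord\<beta>[OF True], of "- lam"] by (simp add: 3 \<beta>_def)
      next
        case False
        then show ?thesis by (simp add: 3 \<beta>_def lspan_zero)
      qed
    qed
  qed
  have \<gamma>Y: "\<gamma> j \<in> lspan Y (rowfun Cb)" if jK: "j \<in> K" for j
  proof -
    consider (1) i where "j = Inl i" "i < r" | (2) z where "j = Inr (Inl z)" "z \<in> ZS"
      | (3) z where "j = Inr (Inr z)" "z \<in> ZN" using jK by (auto simp: K_def)
    then show ?thesis
    proof cases
      case 1
      have "\<gamma>0 i \<in> lspan Y (rowfun Cb)"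
      proof (rule lspan_mono[OF fin(2) \<gamma>0[OF 1(2)]])
        show "rows_of C T \<subseteq> Y" using Y dT dA by (force simp: rows_of_def Cb_def Cbar_dims)
        show "rowfun C k = rowfun Cb k" if "k \<in> rows_of C T" for k
          using that dT dA by (auto simp: rows_of_def Cb_def rowfun_Cbar_state)
      qed
      then show ?thesis by (simp add: 1 \<gamma>_def)
    next
      case 2
      then show ?thesis by (simp add: \<gamma>_def lspan_zero)
    next
      case 3
      then show ?thesis using coord\<gamma> by (simp add: \<gamma>_def)
    qed
  qed
  have w_trunc: "w (trunc_fun n u) v = w u v" "w u (trunc_fun n v) = w u v" for u v
    by (intro w_cong; simp add: trunc_fun_def)+
  have W_trunc: "W (trunc_fun n u) v = w u v" "W u (trunc_fun n v) = w u v" for u v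
    by (simp_all add: Ww w_trunc) (simp_all add: trunc_fun_def)
  have w_unit: "w (unit_fun (e z)) v = 0" "w u (unit_fun (e z)) = 0" for z u v
    using w_cong[of "unit_fun (e z)" "\<lambda>_. 0" v v] w_cong[of u u "unit_fun (e z)" "\<lambda>_. 0"] e_ge[of z]
    by (auto simp: unit_fun_def w_zero)
  have w_zeroW: "W (\<lambda>_. 0) v = 0" "W u (\<lambda>_. 0) = 0" for u v by (simp_all add: Ww w_zero)
  have W_unit: "W (unit_fun (e z)) (unit_fun (e z')) = (if z = z' then lam else 0)"
    if z: "z \<in> ZS \<union> ZN" "z' \<in> ZS \<union> ZN" for z z'
  proof -
    have "(\<Sum>x<(\<Sum>k<m. nn k). unit_fun (e z) (n + x) * unit_fun (e z') (n + x))
      = (\<Sum>x<(\<Sum>k<m. nn k). (if x = zoff nn (fst z) + snd z then 1 else 0) * unit_fun (e z') (n + x))"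
      by (intro sum.cong) (auto simp: unit_fun_def e_def)
    also have "\<dots> = unit_fun (e z') (e z)" using e_less[OF z(1)] by (simp add: sum_mult_delta e_def)
    also have "\<dots> = (if z = z' then 1 else 0)" using e_inj[OF z] by (simp add: unit_fun_def)
    finally show ?thesis by (simp add: Ww w_unit)
  qed
  have \<beta>_unit: "\<beta>0 j (unit_fun (e z)) = 0" if "j < r" for j z
    using \<beta>_cong[OF that, of "unit_fun (e z)" "\<lambda>_. 0"] \<beta>_zero[OF that] e_ge[of z]
    by (auto simp: unit_fun_def)
  have \<gamma>_unit: "\<gamma>0 j (unit_fun (e z)) = 0" if "j < r" for j z
    using \<gamma>_cong[OF that, of "unit_fun (e z)" "\<lambda>_. 0"] \<gamma>_zero[OF that] e_ge[of z]
    by (auto simp: unit_fun_def)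
  have \<beta>_trunc: "\<beta>0 j (trunc_fun n u) = \<beta>0 j u" if "j < r" for j u
    using \<beta>_cong[OF that, of "trunc_fun n u" u] by (simp add: trunc_fun_def)
  have \<gamma>_trunc: "\<gamma>0 j (trunc_fun n u) = \<gamma>0 j u" if "j < r" for j u
    using \<gamma>_cong[OF that, of "trunc_fun n u" u] by (simp add: trunc_fun_def)
  have trunc_e: "trunc_fun n u (e z) = 0" for u z using e_ge[of z] by (simp add: trunc_fun_def)
  have unit_e: "unit_fun (e z) (e z') = (if z = z' then 1 else 0)"
    if "z \<in> ZS \<union> ZN" "z' \<in> ZS \<union> ZN" for z z'
    using e_inj[OF that] by (auto simp: unit_fun_def)
  have "W (p i) (q j) + \<beta> j (p i) + \<gamma> i (q j) = (if i = j then 1 else 0)" if "i \<in> K" "j \<in> K" for i j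
    using that id0 unfolding K_def
    by (auto elim!: PlusE simp: p_def q_def \<beta>_def \<gamma>_def W_trunc w_unit w_zeroW W_unit w_zero
        \<beta>_unit \<gamma>_unit \<beta>_trunc \<gamma>_trunc \<beta>_zero \<gamma>_zero trunc_e unit_e w_trunc w_def[symmetric]
        split: if_splits)
  moreover have "finite K" "card K = r + (\<Sum>k\<in>S. nn k) + (\<Sum>k\<in>\<Union>(N ` T). nn k)"
    using finS by (simp_all add: K_def ZS_def ZN_def card_Plus)
  ultimately show ?thesis using \<beta>X \<gamma>Y unfolding W_def 
    by (intro rank_ge_augI[where K = K and p = p and q = q and \<beta> = \<beta> and \<gamma> = \<gamma>]) simp_all
qed

section \<open>Output feedback as a combination of rank-one forms\<close>

lemma bilinear_product_form:
  assumes M: "M \<in> carrier_mat n c" and F: "F \<in> carrier_mat c d" and L: "L \<in> carrier_mat d n"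
  shows "(\<Sum>a<n. \<Sum>b<n. u a * complex_of_real ((M * F * L) $$ (a, b)) * v b)
    = (\<Sum>\<alpha><c. \<Sum>\<beta><d. of_real (F $$ (\<alpha>, \<beta>)) *
        ((\<Sum>a<n. u a * of_real (M $$ (a, \<alpha>))) * (\<Sum>b<n. of_real (L $$ (\<beta>, b)) * v b)))"
proof -
  define R where "R \<beta> = (\<Sum>b<n. of_real (L $$ (\<beta>, b)) * v b)" for \<beta>
  have MF: "M * F \<in> carrier_mat n d" using M F by simp
  have "(\<Sum>b<n. u a * complex_of_real ((M * F * L) $$ (a, b)) * v b)
      = (\<Sum>\<alpha><c. (u a * of_real (M $$ (a, \<alpha>))) * (\<Sum>\<beta><d. of_real (F $$ (\<alpha>, \<beta>)) * R \<beta>))"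
    if a: "a < n" for a
  proof -
    have "(\<Sum>b<n. u a * complex_of_real ((M * F * L) $$ (a, b)) * v b)
        = (\<Sum>b<n. \<Sum>\<beta><d. u a * of_real ((M * F) $$ (a, \<beta>)) * (of_real (L $$ (\<beta>, b)) * v b))"
      using mult_mat_entry[OF MF L a]
      by (intro sum.cong refl) (simp add: sum_distrib_left sum_distrib_right mult.assoc)
    also have "\<dots> = (\<Sum>\<beta><d. u a * of_real ((M * F) $$ (a, \<beta>)) * R \<beta>)"
      by (subst sum.swap) (simp add: R_def sum_distrib_left)
    also have "\<dots> = (\<Sum>\<beta><d. \<Sum>\<alpha><c. (u a * of_real (M $$ (a, \<alpha>))) * (of_real (F $$ (\<alpha>, \<beta>)) * R \<beta>))"
      using mult_mat_entry[OF M F a]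
      by (intro sum.cong refl) (simp add: sum_distrib_left sum_distrib_right mult.assoc)
    also have "\<dots> = (\<Sum>\<alpha><c. (u a * of_real (M $$ (a, \<alpha>))) * (\<Sum>\<beta><d. of_real (F $$ (\<alpha>, \<beta>)) * R \<beta>))"
      by (subst sum.swap) (simp add: sum_distrib_left)
    finally show ?thesis .
  qed
  then have "(\<Sum>a<n. \<Sum>b<n. u a * complex_of_real ((M * F * L) $$ (a, b)) * v b)
      = (\<Sum>a<n. \<Sum>\<alpha><c. (u a * of_real (M $$ (a, \<alpha>))) * (\<Sum>\<beta><d. of_real (F $$ (\<alpha>, \<beta>)) * R \<beta>))"
    by simp
  also have "\<dots> = (\<Sum>\<alpha><c. (\<Sum>a<n. u a * of_real (M $$ (a, \<alpha>))) * (\<Sum>\<beta><d. of_real (F $$ (\<alpha>, \<beta>)) * R \<beta>))"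
    by (subst sum.swap) (simp add: sum_distrib_right)
  finally show ?thesis by (simp add: R_def sum_distrib_left mult.left_commute)
qed

text \<open>Brings the closed loop into the shape of \<open>generic_rank\<close>: the free
  coefficients are the negated entries of the feedback matrices.\<close>

lemma mform_closed_loop:
  assumes A: "A \<in> carrier_mat n n"
    and B: "\<And>i. i < m \<Longrightarrow> dim_row (B i) = n" and C: "\<And>i. i < m \<Longrightarrow> dim_col (C i) = n"
    and F: "\<And>i. i < m \<Longrightarrow> F i \<in> carrier_mat (dim_col (B i)) (dim_row (C i))"
  shows "mform (shift_mat (closed_loop A B C m F) lam) u v = mform (shift_mat A lam) u v
    - (\<Sum>i<m. \<Sum>\<alpha><dim_col (B i). \<Sum>\<beta><dim_row (C i).
        of_real (F i $$ (\<alpha>, \<beta>)) * (colfun B (i, \<alpha>) u * rowfun C (i, \<beta>) v))"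
proof -
  have d: "dim_row (closed_loop A B C m F) = n" "dim_col (closed_loop A B C m F) = n"
    "dim_row A = n" "dim_col A = n"
    using A by (simp_all add: closed_loop_def)
  have e: "shift_mat (closed_loop A B C m F) lam $$ (a, b)
      = shift_mat A lam $$ (a, b) - (\<Sum>i<m. of_real ((B i * F i * C i) $$ (a, b)))"
    if "a < n" "b < n" for a b
    using that by (simp add: shift_mat_entry d) (simp add: closed_loop_def d)
  have "mform (shift_mat (closed_loop A B C m F) lam) u v
      = (\<Sum>a<n. \<Sum>b<n. u a * shift_mat A lam $$ (a, b) * v b
          - (\<Sum>i<m. u a * of_real ((B i * F i * C i) $$ (a, b)) * v b))"
    unfolding mform_def shift_mat_dim d
    by (intro sum.cong refl) (simp add: e algebra_simps sum_distrib_left sum_distrib_right)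
  also have "\<dots> = mform (shift_mat A lam) u v
      - (\<Sum>a<n. \<Sum>b<n. \<Sum>i<m. u a * of_real ((B i * F i * C i) $$ (a, b)) * v b)"
    by (simp add: mform_def shift_mat_dim d sum_subtractf)
  also have "(\<Sum>a<n. \<Sum>b<n. \<Sum>i<m. u a * of_real ((B i * F i * C i) $$ (a, b)) * v b)
      = (\<Sum>a<n. \<Sum>i<m. \<Sum>b<n. u a * of_real ((B i * F i * C i) $$ (a, b)) * v b)"
    by (rule sum.cong[OF refl], rule sum.swap)
  also have "\<dots> = (\<Sum>i<m. \<Sum>a<n. \<Sum>b<n. u a * of_real ((B i * F i * C i) $$ (a, b)) * v b)"
    by (rule sum.swap)
  also have "\<dots> = (\<Sum>i<m. \<Sum>\<alpha><dim_col (B i). \<Sum>\<beta><dim_row (C i).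
        of_real (F i $$ (\<alpha>, \<beta>)) * (colfun B (i, \<alpha>) u * rowfun C (i, \<beta>) v))"
  proof (rule sum.cong[OF refl])
    fix i assume "i \<in> {..<m}"
    then have i: "i < m" by simp
    have "B i \<in> carrier_mat n (dim_col (B i))" "C i \<in> carrier_mat (dim_row (C i)) n"
      using B[OF i] C[OF i] by auto
    from bilinear_product_form[OF this(1) F[OF i] this(2), of u v]
    show "(\<Sum>a<n. \<Sum>b<n. u a * of_real ((B i * F i * C i) $$ (a, b)) * v b)
      = (\<Sum>\<alpha><dim_col (B i). \<Sum>\<beta><dim_row (C i).
        of_real (F i $$ (\<alpha>, \<beta>)) * (colfun B (i, \<alpha>) u * rowfun C (i, \<beta>) v))"
      by (simp add: colfun_def rowfun_def B[OF i] C[OF i])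
  qed
  finally show ?thesis .
qed

text \<open>A path from inside \<open>S\<close> to outside must cross along some arc; if no arc left
  \<open>S\<close>, induction along the path would keep it in \<open>S\<close>.\<close>

lemma strongly_connected_overlap:
  assumes sc: "strongly_connected_nbr m N" and S: "S \<subseteq> {0..<m}" "S \<noteq> {}" "S \<noteq> {0..<m}"
  shows "\<exists>k\<in>S. \<exists>i\<in>{0..<m} - S. k \<in> N i"
proof -
  obtain a b where a: "a \<in> S" and b: "b \<in> {0..<m} - S" using S by blast
  then have "a < m" "b < m" using S(1) by auto
  then have path: "(a, b) \<in> (nbr_arcs m N)\<^sup>*" using sc by (simp add: strongly_connected_nbr_def)
  show ?thesis
  proof (rule ccontr)
    assume "\<not> ?thesis"
    then have no: "k \<notin> N i" if "k \<in> S" "i \<in> {0..<m} - S" for k i using that by blast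
    from path have "b \<in> S"
    proof (induction rule: rtrancl_induct)
      case base
      show ?case by (rule a)
    next
      case (step y z)
      then have "z < m" "y \<in> N z" by (auto simp: nbr_arcs_def)
      then show ?case using no[of y z] step.IH by auto
    qed
    with b show False by simp
  qed
qed

lemma infinite_range_of_real: "infinite (range complex_of_real)"
  using finite_imageD[of complex_of_real UNIV] infinite_UNIV_char_0[where 'a = real]
  by (auto simp: inj_of_real)

theorem theorem2:
  fixes n m :: nat
    and A :: "real mat" and B C :: "nat \<Rightarrow> real mat"
    and p q nn :: "nat \<Rightarrow> nat" and N :: "nat \<Rightarrow> nat set"
  assumes A_dim: "A \<in> carrier_mat n n"
    and B_dim: "\<forall>i<m. B i \<in> carrier_mat n (p i)"
    and C_dim: "\<forall>i<m. C i \<in> carrier_mat (q i) n"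
    and nbr: "\<forall>i<m. N i \<subseteq> {0..<m} \<and> i \<in> N i"
    and jctrb: "controllable A (hcat n B {0..<m})"
    and jobsv: "observable (vcat n C {0..<m}) A"
    and sc: "strongly_connected_nbr m N"
    and bound: "\<forall>i<m. \<forall>s \<subseteq> {0..<m}. \<forall>lam. eigenvalue (map_mat complex_of_real A) lam \<longrightarrow>
                   int (nn i) \<ge> int n - int (mrank (pbh_mat A B C m s lam))"
  shows "fixed_spectrum (Abar A m nn) (Bbar A B m nn) (Cbar A C m nn N) m = {}"
proof (rule ccontr)
  assume "\<not> ?thesis"
  then obtain lam where lam: "lam \<in> fixed_spectrum (Abar A m nn) (Bbar A B m nn) (Cbar A C m nn N) m"
    by blast
  define Ab Bb Cb where "Ab = Abar A m nn" and "Bb = Bbar A B m nn" and "Cb = Cbar A C m nn N"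
  define nb where "nb = n + (\<Sum>k<m. nn k)"
  have dA: "dim_row A = n" using A_dim by simp
  have dB: "dim_row (B i) = n" if "i < m" for i using B_dim that by auto
  have dC: "dim_col (C i) = n" if "i < m" for i using C_dim that by auto
  have Ab: "Ab \<in> carrier_mat nb nb" using A_dim by (auto simp: Ab_def Abar_def Let_def nb_def)
  have dBb: "dim_row (Bb i) = nb" if "i < m" for i using dA dB[OF that] by (simp add: Bb_def nb_def Bbar_dims)
  have dCb: "dim_col (Cb i) = nb" if "i < m" for i using dA dC[OF that] by (simp add: Cb_def nb_def Cbar_dims)
  define I where "I = (SIGMA i:{..<m}. {..<dim_col (Bb i)} \<times> {..<dim_row (Cb i)})"
  \<comment> \<open>Each entry of \<open>F i\<close> couples one column with one row of the same
    channel; \<open>J\<close> is the set of these couplings.\<close>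
  define f where "f = (\<lambda>(i :: nat, \<alpha> :: nat, \<beta> :: nat). ((i, \<alpha>), (i, \<beta>)))"
  define J where "J = f ` I"
  have "finite I" by (auto simp: I_def)
  then have finJ: "finite J" by (simp add: J_def)
  have rank: "rank_ge nb (aug (fst ` s) (snd ` (J - s)) (mform (shift_mat Ab lam)) (colfun Bb) (rowfun Cb))"
    if s: "s \<subseteq> J" for s
  proof -
    \<comment> \<open>A subset \<open>s\<close> may split the couplings of one channel.
      \<open>S\<close> collects the channels all of whose columns are in the border. Any other
      channel misses some column, so all couplings of that column lie outside \<open>s\<close>, and
      they put every row of the channel into the border. Hence each mixed choice contains a border
      given by whole channels.\<close>
    define S where "S = {i\<in>{0..<m}. \<forall>\<alpha><dim_col (Bb i). (i, \<alpha>) \<in> fst ` s}"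
    define T where "T = {0..<m} - S"
    define U where "U = \<Union>(N ` T)"
    have S: "S \<subseteq> {0..<m}" and T: "T \<subseteq> {0..<m}" by (auto simp: S_def T_def)
    have Tm: "i < m" if "i \<in> T" for i using T that by auto
    \<comment> \<open>Every channel is its own neighbor, so the controller states of
      \<open>T\<close> are all measured from \<open>T\<close>.\<close>
    have U: "T \<subseteq> U" using nbr Tm unfolding U_def by blast
    have Um: "U \<subseteq> {0..<m}" using nbr Tm unfolding U_def by blast
    have "finite s" using s finJ finite_subset by blast
    then have fin: "finite (fst ` s)" "finite (snd ` (J - s))" using finJ by auto
    have cols: "cols_of Bb S \<subseteq> fst ` s" by (auto simp: S_def cols_of_def)
    have rows: "rows_of Cb T \<subseteq> snd ` (J - s)"
    proof
      fix k assume "k \<in> rows_of Cb T"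
      then obtain i \<beta> where k: "k = (i, \<beta>)" "i \<in> T" "\<beta> < dim_row (Cb i)" by (auto simp: rows_of_def)
      then obtain \<alpha> where \<alpha>: "i < m" "\<alpha> < dim_col (Bb i)" "(i, \<alpha>) \<notin> fst ` s"
        by (auto simp: T_def S_def)
      have "f (i, \<alpha>, \<beta>) \<in> J" using k \<alpha> by (auto simp: J_def I_def)
      then have "((i, \<alpha>), k) \<in> J - s" using \<alpha>(3) k(1) by (force simp: f_def)
      then show "k \<in> snd ` (J - s)" by force
    qed
    have split: "(\<Sum>k\<in>S. nn k) + (\<Sum>k\<in>T. nn k) = (\<Sum>k<m. nn k)"
      using sum.subset_diff[of S "{0..<m}" nn] S by (simp add: T_def atLeast0LessThan add.commute)
    have Ule: "(\<Sum>k\<in>T. nn k) \<le> (\<Sum>k\<in>U. nn k)"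
      using U finite_subset[OF Um] by (intro sum_mono2) auto
    \<comment> \<open>The controller states in \<open>S\<close> and \<open>U\<close> must make up
      for the defect \<open>n - r\<close>. At the two extremes of \<open>S\<close> there is none; in
      between, the graph gives a surplus block.\<close>
    have "\<exists>r. pbh_witness A B C S T lam r \<and> nb \<le> r + (\<Sum>k\<in>S. nn k) + (\<Sum>k\<in>U. nn k)"
    proof -
      consider "S = {0..<m}" | "S = {}" | "S \<noteq> {0..<m}" "S \<noteq> {}" by blast
      then show ?thesis
      proof cases
        case 1
        then have "T = {}" by (simp add: T_def)
        with 1 pbh_witness_controllable[OF A_dim dB dC jctrb] have "pbh_witness A B C S T lam n" by simp
        then show ?thesis using split Ule by (intro exI[of _ n]) (simp add: nb_def)
      next
        case 2
        then have "T = {0..<m}" by (simp add: T_def)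
        with 2 pbh_witness_observable[OF A_dim dB dC jobsv] have "pbh_witness A B C S T lam n" by simp
        then show ?thesis using split Ule by (intro exI[of _ n]) (simp add: nb_def)
      next
        case 3
        obtain k i where k: "k \<in> S" "i \<in> T" "k \<in> N i"
          using strongly_connected_overlap[OF sc S 3(2,1)] unfolding T_def by blast
        have "k < m" using S k(1) by auto
        \<comment> \<open>Block \<open>k\<close> is controlled from \<open>S\<close> and measured
          from \<open>T\<close>, so it adds \<open>nn k\<close> beyond the full controller
          dimension.\<close>
        have kU: "insert k T \<subseteq> U" using U k by (auto simp: U_def)
        have "(\<Sum>k\<in>insert k T. nn k) \<le> (\<Sum>k\<in>U. nn k)"
          using kU finite_subset[OF Um] by (intro sum_mono2) auto
        moreover have "k \<notin> T" "finite T" using k(1) by (simp_all add: T_def)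
        ultimately have le: "nn k + (\<Sum>k\<in>T. nn k) \<le> (\<Sum>k\<in>U. nn k)" by simp
        show ?thesis
        proof (cases "eigenvalue (map_mat complex_of_real A) lam")
          case True
          have "int (nn k) \<ge> int n - int (mrank (pbh_mat A B C m S lam))"
            using bound True S \<open>k < m\<close> by blast
          then have "n \<le> mrank (pbh_mat A B C m S lam) + nn k" by linarith
          moreover have "pbh_witness A B C S T lam (mrank (pbh_mat A B C m S lam))"
            unfolding T_def by (rule pbh_witnessI[OF A_dim dB dC S rank_ge_mrank]) simp_all
          ultimately show ?thesis using split le by (intro exI conjI) (auto simp: nb_def)
        next
          \<comment> \<open>The bound concerns only eigenvalues of \<open>A\<close>; at any other
            \<open>lam\<close> the original system has no defect.\<close>
          case False
          then show ?thesis using pbh_witness_noneigenvalue[OF A_dim] split Ule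
            by (intro exI[of _ n] conjI) (auto simp: nb_def)
        qed
      qed
    qed
    then obtain r where r: "pbh_witness A B C S T lam r" "nb \<le> r + (\<Sum>k\<in>S. nn k) + (\<Sum>k\<in>U. nn k)"
      by blast
    have "rank_ge (r + (\<Sum>k\<in>S. nn k) + (\<Sum>k\<in>U. nn k))
        (aug (fst ` s) (snd ` (J - s)) (mform (shift_mat Ab lam)) (colfun Bb) (rowfun Cb))"
      unfolding U_def Ab_def
      by (rule extended_rank[OF Bb_def Cb_def A_dim dB dC _ S T fin cols rows r(1)]) (use nbr in auto)
    from this r(2) show ?thesis by (rule rank_ge_mono)
  qed
  \<comment> \<open>Taking \<open>X\<close> to be the real numbers inside the complex ones keeps the
    feedback real although \<open>lam\<close> may be complex.\<close>
  obtain x where x: "\<And>j. j \<in> J \<Longrightarrow> x j \<in> range complex_of_real"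
    and rk: "rank_ge nb (\<lambda>u v. mform (shift_mat Ab lam) u v
      + (\<Sum>j\<in>J. x j * (colfun Bb (fst j) u * rowfun Cb (snd j) v)))"
    using generic_rank[OF finJ infinite_range_of_real bilinear_mform linear_colfun linear_rowfun rank] by blast
  \<comment> \<open>The sign turns the added combination into \<open>lam I - A\<close> minus the
    feedback terms.\<close>
  define F where "F i = mat (dim_col (Bb i)) (dim_row (Cb i)) (\<lambda>(\<alpha>, \<beta>). - Re (x (f (i, \<alpha>, \<beta>))))" for i
  define L where "L = closed_loop Ab Bb Cb m F"
  have F: "F i \<in> carrier_mat (dim_col (Bb i)) (dim_row (Cb i))" for i by (simp add: F_def)
  have L: "L \<in> carrier_mat nb nb" using Ab by (auto simp: L_def closed_loop_def)
  have sumJ: "(\<Sum>j\<in>J. x j * (colfun Bb (fst j) u * rowfun Cb (snd j) v))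
      = (\<Sum>i<m. \<Sum>\<alpha><dim_col (Bb i). \<Sum>\<beta><dim_row (Cb i).
          x (f (i, \<alpha>, \<beta>)) * (colfun Bb (i, \<alpha>) u * rowfun Cb (i, \<beta>) v))" for u v
  proof -
    have "inj_on f I" by (auto simp: inj_on_def f_def)
    then have "(\<Sum>j\<in>J. x j * (colfun Bb (fst j) u * rowfun Cb (snd j) v))
        = (\<Sum>(i, \<alpha>, \<beta>)\<in>I. x (f (i, \<alpha>, \<beta>)) * (colfun Bb (i, \<alpha>) u * rowfun Cb (i, \<beta>) v))"
      unfolding J_def by (subst sum.reindex) (auto simp: f_def intro!: sum.cong)
    also have "\<dots> = (\<Sum>i<m. \<Sum>(\<alpha>, \<beta>)\<in>{..<dim_col (Bb i)} \<times> {..<dim_row (Cb i)}.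
          x (f (i, \<alpha>, \<beta>)) * (colfun Bb (i, \<alpha>) u * rowfun Cb (i, \<beta>) v))"
      unfolding I_def by (subst sum.Sigma) auto
    finally show ?thesis by (simp add: sum.cartesian_product)
  qed
  have xF: "x (f (i, \<alpha>, \<beta>)) = - of_real (F i $$ (\<alpha>, \<beta>))"
    if "i < m" "\<alpha> < dim_col (Bb i)" "\<beta> < dim_row (Cb i)" for i \<alpha> \<beta>
  proof -
    have "f (i, \<alpha>, \<beta>) \<in> J" using that by (auto simp: J_def I_def)
    from x[OF this] show ?thesis using that by (auto simp: F_def)
  qed
  have "mform (shift_mat L lam) u v = mform (shift_mat Ab lam) u v
      + (\<Sum>j\<in>J. x j * (colfun Bb (fst j) u * rowfun Cb (snd j) v))" for u v
    using mform_closed_loop[where m = m and lam = lam and u = u and v = v, OF Ab dBb dCb F]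
    by (simp add: L_def sumJ xF sum_negf)
  then have rL: "rank_ge nb (mform (shift_mat L lam))" using rk by presburger
  have "eigenvalue (map_mat complex_of_real L) lam"
    using lam F unfolding fixed_spectrum_def L_def Ab_def Bb_def Cb_def by blast
  then obtain v b where v: "b < nb" "v b \<noteq> 0"
    "\<And>a. a < nb \<Longrightarrow> (\<Sum>b<nb. shift_mat L lam $$ (a, b) * v b) = 0"
    using eigenvalue_iff_shift_kernel[OF L] by blast
  have d: "dim_row (shift_mat L lam) = nb" "dim_col (shift_mat L lam) = nb"
    using L by (simp_all add: shift_mat_dim)
  \<comment> \<open>The closed loop shifted by \<open>lam\<close> has full rank, so it cannot have
    the eigenvector that a fixed \<open>lam\<close> would require.\<close>
  have "v b = 0"
    using right_kernel_trivial[of "shift_mat L lam" v b] rL v(1,3) by (simp add: d)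
  with v(2) show False by simp
qed

end
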